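(* Let $N\ge 1$ be an integer and let $\Omega\subset\mathbb{R}^N$ be either the annulus $\{x\in\mathbb{R}^N : R_1<|x|<R_2\}$ with $0<R_1<R_2<+\infty$, or the ball $\{x\in\mathbb{R}^N : |x|<R_2\}$ with $0<R_2<+\infty$, in which case we set $R_1=0$. Let $f(s)=s^{q-1}-s^{p-1}$ for $s\ge 0$, where $p\ge 2$ and $q$ are real numbers with $q-p>\lambda_{k+1}^{\mathrm{rad}}$ for some integer $k\ge 1$, $\lambda_{k+1}^{\mathrm{rad}}$ being the $(k+1)$-th radial Neumann eigenvalue of $-\Delta$ in $\Omega$. Then there exist at least $2k$ distinct non-constant radial solutions $u_1,\ldots,u_{2k}$ to $$ \begin{cases} -\operatorname{div}\left(\dfrac{\nabla u}{\sqrt{1-|\nabla u|^2}}\right)=f(u) & \text{in }\Omega,\\ u>0 & \text{in }\Omega,\\ \partial_\nu u=0 & \text{on }\partial\Omega. \end{cases} $$ Moreover, writing $u_j(x)=u_j(r)$ with $r=|x|$: (i) $u_j(R_1)<1$ for every $j=1,\ldots,k$; (ii) $u_j(R_1)>1$ for every $j=k+1,\ldots,2k$; (iii) $u_j(r)-1$ and $u_{j+k}(r)-1$ have exactly $j$ zeros for $r\in(R_1,R_2)$, for every $j=1,\ldots,k$.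
   Context: Here $\nu$ is the outer unit normal of $\partial\Omega$. For $p=2$ one has $s^{p-1}=s$, so $f(0)=0$ in all cases. Solutions are radial functions of class $C^2(\overline{\Omega})$ (with $|\nabla u|<1$, so that the equation makes sense), and a radial function $u(x)$ is identified with the function $u(r)$, $r=|x|$. Equivalently, in radial form, $\left(r^{N-1}\frac{u'}{\sqrt{1-(u')^2}}\right)'+r^{N-1}f(u)=0$ and $u>0$ in $(R_1,R_2)$, with $u'(R_1)=u'(R_2)=0$. The radial Neumann eigenvalues $\lambda_k^{\mathrm{rad}}$ are the values $\lambda$ for which the problem $-(r^{N-1}u')'=\lambda r^{N-1}u$ in $(R_1,R_2)$, $u'(R_1)=u'(R_2)=0$, has a nontrivial solution. It is known that they are all simple and form an increasing sequence $0=\lambda_1^{\mathrm{rad}}<\lambda_2^{\mathrm{rad}}<\cdots<\lambda_k^{\mathrm{rad}}<\cdots\to+\infty$. *)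

theory Defs
  imports "HOL-Analysis.Analysis"
begin

definition gradient :: "('a::euclidean_space \<Rightarrow> real) \<Rightarrow> 'a \<Rightarrow> 'a" where
  "gradient u x = (\<Sum>b\<in>Basis. frechet_derivative u (at x) b *\<^sub>R b)"

definition divergence :: "('a::euclidean_space \<Rightarrow> 'a) \<Rightarrow> 'a \<Rightarrow> real" where
  "divergence F x = (\<Sum>b\<in>Basis. frechet_derivative F (at x) b \<bullet> b)"

text \<open>Class \<open>C\<^sup>2\<close> up to the boundary of an open set \<open>\<Omega>\<close>: \<open>u\<close> is twice differentiable
  in \<open>\<Omega>\<close>, and \<open>u\<close>, its gradient \<open>G\<close> and its Hessian \<open>H\<close> extend continuously to the
  closure; the boundary values of \<open>G\<close> and \<open>H\<close> are those extensions.\<close>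

definition C2_closure :: "'a::euclidean_space set \<Rightarrow> ('a \<Rightarrow> real) \<Rightarrow> bool" where
  "C2_closure \<Omega> u \<longleftrightarrow> continuous_on (closure \<Omega>) u \<and>
     (\<exists>(G :: 'a \<Rightarrow> 'a) (H :: 'a \<Rightarrow> 'a \<Rightarrow>\<^sub>L 'a).
        continuous_on (closure \<Omega>) G \<and> continuous_on (closure \<Omega>) H \<and>
        (\<forall>x\<in>\<Omega>. (u has_derivative (\<lambda>h. G x \<bullet> h)) (at x) \<and>
               (G has_derivative blinfun_apply (H x)) (at x)))"

text \<open>Outer unit normal at boundary points of the annulus \<open>R1 < norm x < R2\<close>, or of the
  ball of radius \<open>R2\<close> centred at the origin when \<open>R1 = 0\<close> (then the first branch is never
  taken on the boundary).\<close>

definition outer_normal :: "real \<Rightarrow> 'a::euclidean_space \<Rightarrow> 'a" where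
  "outer_normal R1 x = (if norm x = R1 then - sgn x else sgn x)"

text \<open>\<open>D\<close> is the derivative of \<open>u\<close> at the boundary point \<open>x\<close> in the outer direction \<open>n\<close>;
  the difference quotient is one-sided because \<open>u\<close> is only given on the closure of the domain,
  that is, for \<open>t \<le> 0\<close>.\<close>

definition has_normal_derivative ::
  "('a::euclidean_space \<Rightarrow> real) \<Rightarrow> 'a \<Rightarrow> 'a \<Rightarrow> real \<Rightarrow> bool" where
  "has_normal_derivative u n x D \<longleftrightarrow>
     ((\<lambda>t. u (x + t *\<^sub>R n)) has_real_derivative D) (at_left 0)"

text \<open>Positive classical solutions of the Neumann problem for the Minkowski mean curvature
  equation; \<open>\<nu>\<close> is the outer unit normal field. The gradient bound makes the square root
  positive.\<close>

definition minkowski_neumann_solution ::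
  "'a::euclidean_space set \<Rightarrow> ('a \<Rightarrow> 'a) \<Rightarrow> (real \<Rightarrow> real) \<Rightarrow> ('a \<Rightarrow> real) \<Rightarrow> bool" where
  "minkowski_neumann_solution \<Omega> \<nu> f u \<longleftrightarrow>
     C2_closure \<Omega> u \<and>
     (\<forall>x\<in>\<Omega>. norm (gradient u x) < 1) \<and>
     (\<forall>x\<in>\<Omega>. - divergence (\<lambda>y. (1 / sqrt (1 - (norm (gradient u y))\<^sup>2)) *\<^sub>R gradient u y) x
              = f (u x)) \<and>
     (\<forall>x\<in>\<Omega>. u x > 0) \<and>
     (\<forall>x\<in>frontier \<Omega>. has_normal_derivative u (\<nu> x) x 0)"

text \<open>\<open>lam\<close> admits a nontrivial solution, \<open>C\<^sup>1\<close> up to the end points, of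
  \<open>-(r\<^bsup>N-1\<^esup> u')' = lam r\<^bsup>N-1\<^esup> u\<close> in \<open>(R1,R2)\<close> with \<open>u'(R1) = u'(R2) = 0\<close>.\<close>

definition radial_neumann_eigenvalue :: "nat \<Rightarrow> real \<Rightarrow> real \<Rightarrow> real \<Rightarrow> bool" where
  "radial_neumann_eigenvalue N R1 R2 lam \<longleftrightarrow>
     (\<exists>u u'. continuous_on {R1..R2} u' \<and>
        (\<forall>r\<in>{R1..R2}. (u has_real_derivative u' r) (at r within {R1..R2})) \<and>
        (\<forall>r\<in>{R1<..<R2}.
           ((\<lambda>s. s ^ (N - 1) * u' s) has_real_derivative - (lam * r ^ (N - 1) * u r)) (at r)) \<and>
        u' R1 = 0 \<and> u' R2 = 0 \<and>
        (\<exists>r\<in>{R1..R2}. u r \<noteq> 0))"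

text \<open>\<open>lam\<close> is the \<open>k\<close>-th radial Neumann eigenvalue in increasing order, counting from
  \<open>k = 1\<close>. The eigenvalues are simple, so the values are counted without multiplicity.\<close>

definition is_kth_radial_neumann_eigenvalue ::
  "nat \<Rightarrow> real \<Rightarrow> real \<Rightarrow> nat \<Rightarrow> real \<Rightarrow> bool" where
  "is_kth_radial_neumann_eigenvalue N R1 R2 k lam \<longleftrightarrow>
     radial_neumann_eigenvalue N R1 R2 lam \<and>
     finite {\<mu>. radial_neumann_eigenvalue N R1 R2 \<mu> \<and> \<mu> \<le> lam} \<and>
     card {\<mu>. radial_neumann_eigenvalue N R1 R2 \<mu> \<and> \<mu> \<le> lam} = k"

end

theory Submission imports Defs begin

text \<open>Put \<open>m = N - 1\<close> and \<open>h x = x / sqrt (1 + x\<^sup>2)\<close>. In radial form the problem is the system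
  \<open>u' = h w\<close>, \<open>(r ^ m * w)' = - r ^ m * f u\<close> with \<open>w = 0\<close> at both ends. The proof is a shooting
  argument in the initial value \<open>u R1 = 1 + e\<close>, which counts half turns around the constant
  solution \<open>1\<close>.

  With \<open>u = 1 + e * A\<close> and \<open>w = e * P\<close>, the pair \<open>(A, P)\<close> solves a system of the same kind, with
  \<open>A R1 = 1\<close> and with \<open>h\<close> and \<open>f\<close> replaced by \<open>h (e * x) / e\<close> and \<open>f (1 + e * x) / e\<close>. These
  functions extend continuously to \<open>e = 0\<close>, where the system is the linear eigenvalue equation with
  \<open>\<lambda> = q - p\<close>. After a truncation of \<open>f\<close> all of them are Lipschitz with a common constant. Hence
  every system has exactly one solution on the whole interval, by a contraction in a weighted norm
  (\<open>picard_fixed_point_exists\<close>), and it depends continuously on \<open>e\<close> (\<open>A_close\<close>). The total angle by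
  which \<open>(A, r ^ m * P)\<close> turns around the origin is the integral of an explicit continuous function
  (\<open>polar\<close>), so it is a continuous function \<open>rot\<close> of \<open>e\<close> (\<open>continuous_rotation\<close>).

  Three values of \<open>rot\<close> decide the matter. For \<open>e = -1\<close> the solution \<open>u\<close> is the constant \<open>0\<close> and
  there is no rotation (\<open>rot_minus_one\<close>). For \<open>e = R2 - R1 + 1\<close> the bound \<open>\<bar>u'\<bar> < 1\<close> keeps \<open>u\<close> above
  \<open>1\<close>, and the rotation is less than \<open>pi\<close> (\<open>rot_large\<close>). For \<open>e = 0\<close> the rotation exceeds \<open>k * pi\<close>:
  the rotation of the linear equation is strictly increasing in \<open>\<lambda>\<close> (\<open>linear_rotation_strict_mono\<close>)
  and a nonnegative multiple of \<open>pi\<close> at each eigenvalue, so it is at least \<open>k * pi\<close> at the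
  \<open>k + 1\<close>-st eigenvalue and larger at \<open>q - p\<close> (\<open>kth_eigenvalue_rotation\<close>). By the intermediate value
  theorem each \<open>j * pi\<close> with \<open>1 \<le> j \<le> k\<close> is attained for some \<open>e\<close> in \<open>(-1, 0)\<close> and for some \<open>e\<close>
  in \<open>(0, R2 - R1 + 1)\<close>.

  If \<open>rot e = j * pi\<close>, then \<open>w\<close> vanishes at \<open>R2\<close>, which is the Neumann condition. The angle is
  nondecreasing and strictly increasing at the zeros of \<open>u - 1\<close>, so there are exactly \<open>j\<close> of them
  (\<open>card_zeros\<close>). A minimum of \<open>u\<close> with a nonpositive value would be an equilibrium of the truncated
  system, which cannot be reached (\<open>shoot_positive\<close>); so \<open>u\<close> is positive and the truncation has no
  effect. Finally \<open>u (norm x)\<close> is of class \<open>C\<^sup>2\<close> up to the boundary and solves the partial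
  differential equation (\<open>radial_solution\<close>); the centre of a ball is treated through the functions
  \<open>w r / r\<close> and \<open>u' r / r\<close>, which are continuous there.\<close>

section \<open>The integral equation\<close>

text \<open>The exponent \<open>m\<close> stands for the dimension minus one; \<open>a = 0\<close> is the case of
  a ball, where the weight \<open>t ^ m\<close> degenerates at the left end.\<close>

locale radial_interval =
  fixes m :: nat and a b :: real
  assumes a_nonneg: "0 \<le> a" and a_less_b: "a < b"
begin

text \<open>If \<open>(s ^ m * P s)' = - s ^ m * \<phi> s\<close> and \<open>s ^ m * P s\<close> vanishes at \<open>a\<close>, then
  \<open>P = - avg \<phi>\<close>. At \<open>s = a = 0\<close> the integral over a point is \<open>0\<close>, so the quotient is \<open>0\<close>,
  which is also the limit.\<close>

definition avg :: "(real \<Rightarrow> real) \<Rightarrow> real \<Rightarrow> real" where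
  "avg \<phi> s = integral {a..s} (\<lambda>t. t ^ m * \<phi> t) / s ^ m"

lemma avg_left_end [simp]: "avg \<phi> a = 0"
  by (simp add: avg_def)

lemma power_times_avg:
  assumes "a \<le> s"
  shows "s ^ m * avg \<phi> s = integral {a..s} (\<lambda>t. t ^ m * \<phi> t)"
proof (cases "s = 0")
  case True
  then have "s = a" using assms a_nonneg by simp
  then show ?thesis by simp
qed (simp add: avg_def)

lemma integrable_weight:
  assumes "continuous_on {a..b} \<phi>" "s \<in> {a..b}"
  shows "(\<lambda>t. t ^ m * \<phi> t) integrable_on {a..s}"
  using assms
  by (intro integrable_continuous_real continuous_intros) (auto elim: continuous_on_subset)

lemma avg_diff:
  assumes "continuous_on {a..b} \<phi>" "continuous_on {a..b} \<psi>" "s \<in> {a..b}"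
  shows "avg \<phi> s - avg \<psi> s = avg (\<lambda>t. \<phi> t - \<psi> t) s"
proof -
  have "integral {a..s} (\<lambda>t. t ^ m * \<phi> t - t ^ m * \<psi> t)
      = integral {a..s} (\<lambda>t. t ^ m * \<phi> t) - integral {a..s} (\<lambda>t. t ^ m * \<psi> t)"
    by (intro integral_diff integrable_weight assms)
  then show ?thesis by (simp add: avg_def diff_divide_distrib right_diff_distrib)
qed

text \<open>The weight \<open>t ^ m / s ^ m\<close> is at most \<open>1\<close> on \<open>{a..s}\<close>; this bound replaces the singular
  kernel by a plain integral in all the estimates.\<close>

lemma abs_avg_le:
  assumes "continuous_on {a..b} \<phi>" "continuous_on {a..b} \<psi>" "s \<in> {a..b}"
    and le: "\<And>t. t \<in> {a..s} \<Longrightarrow> \<bar>\<phi> t\<bar> \<le> \<psi> t"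
  shows "\<bar>avg \<phi> s\<bar> \<le> integral {a..s} \<psi>"
proof (cases "s = 0")
  case True
  then have "s = a" using assms a_nonneg by simp
  then show ?thesis by simp
next
  case False
  then have s: "s > 0" using assms a_nonneg by simp
  have int: "\<psi> integrable_on {a..s}"
    using assms by (intro integrable_continuous_real) (auto elim: continuous_on_subset)
  have "norm (integral {a..s} (\<lambda>t. t ^ m * \<phi> t)) \<le> integral {a..s} (\<lambda>t. s ^ m * \<psi> t)"
  proof (rule integral_norm_bound_integral)
    show "(\<lambda>t. t ^ m * \<phi> t) integrable_on {a..s}" by (rule integrable_weight) fact+
    show "(\<lambda>t. s ^ m * \<psi> t) integrable_on {a..s}" using int by (intro integrable_on_mult_right)
    fix t assume t: "t \<in> {a..s}"
    show "norm (t ^ m * \<phi> t) \<le> s ^ m * \<psi> t"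
      unfolding real_norm_def abs_mult
      by (rule mult_mono) (use t a_nonneg s le[OF t] in \<open>auto simp: power_abs intro!: power_mono\<close>)
  qed
  also have "\<dots> = s ^ m * integral {a..s} \<psi>" by simp
  finally show ?thesis using s by (simp add: avg_def field_simps)
qed

lemma continuous_on_avg:
  assumes "continuous_on {a..b} \<phi>"
  shows "continuous_on {a..b} (avg \<phi>)"
proof -
  obtain C where C: "\<And>t. t \<in> {a..b} \<Longrightarrow> \<bar>\<phi> t\<bar> \<le> C"
    using compact_imp_bounded[OF compact_continuous_image[OF assms compact_Icc]]
    unfolding bounded_iff by (metis imageI real_norm_def)
  have near: "\<bar>avg \<phi> s\<bar> \<le> C * (s - a)" if "s \<in> {a..b}" for s
    using abs_avg_le[of \<phi> "\<lambda>_. C" s] assms that C by (auto simp: mult.commute)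
  have "continuous (at s within {a..b}) (avg \<phi>)" if s: "s \<in> {a..b}" for s
  proof (cases "s = 0")
    case True
    then have "a = 0" "s = a" using s a_nonneg by simp_all
    have "(avg \<phi> \<longlongrightarrow> 0) (at s within {a..b})"
    proof (rule Lim_null_comparison)
      show "\<forall>\<^sub>F x in at s within {a..b}. norm (avg \<phi> x) \<le> C * (x - a)"
        using near by (auto simp: eventually_at_filter)
      have "((\<lambda>x. C * (x - a)) \<longlongrightarrow> C * (s - a)) (at s within {a..b})"
        by (intro tendsto_intros)
      then show "((\<lambda>x. C * (x - a)) \<longlongrightarrow> 0) (at s within {a..b})"
        using True \<open>a = 0\<close> by simp
    qed
    moreover have "avg \<phi> s = 0" unfolding \<open>s = a\<close> by simp
    ultimately show ?thesis unfolding continuous_within by metis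
  next
    case False
    have "continuous_on {a..b} (\<lambda>s. integral {a..s} (\<lambda>t. t ^ m * \<phi> t))"
      using a_less_b by (intro indefinite_integral_continuous_1 integrable_weight[OF assms]) simp
    then have "continuous (at s within {a..b}) (\<lambda>s. integral {a..s} (\<lambda>t. t ^ m * \<phi> t))"
      using s by (simp add: continuous_on_eq_continuous_within)
    then show ?thesis unfolding avg_def using False
      by (intro continuous_intros) auto
  qed
  then show ?thesis by (simp add: continuous_on_eq_continuous_within)
qed

text \<open>Fixed points of this operator are the solutions of \<open>A' = h (P)\<close>, \<open>(r ^ m * P)' = - r ^ m * g (A)\<close>
  with \<open>A a = 1\<close> and zero initial flux. The curvature equation and its linearization both
  have this form.\<close>

definition picard :: "(real \<Rightarrow> real) \<Rightarrow> (real \<Rightarrow> real) \<Rightarrow> (real \<Rightarrow> real) \<Rightarrow> real \<Rightarrow> real" where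
  "picard h g A r = 1 + integral {a..r} (\<lambda>s. h (- avg (\<lambda>t. g (A t)) s))"

lemma integral_exp_le:
  assumes "\<mu> > 0" "S \<ge> 0" "s \<in> {a..b}"
  shows "integral {a..s} (\<lambda>t. S * exp (\<mu> * (t - a))) \<le> S * exp (\<mu> * (s - a)) / \<mu>"
proof -
  have "((\<lambda>t. S * exp (\<mu> * (t - a))) has_integral
      (S * exp (\<mu> * (s - a)) / \<mu> - S * exp (\<mu> * (a - a)) / \<mu>)) {a..s}"
    using assms
    by (intro fundamental_theorem_of_calculus)
      (auto intro!: derivative_eq_intros simp flip: has_real_derivative_iff_has_vector_derivative)
  then have "integral {a..s} (\<lambda>t. S * exp (\<mu> * (t - a))) =
      S * exp (\<mu> * (s - a)) / \<mu> - S * exp (\<mu> * (a - a)) / \<mu>"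
    by (rule integral_unique)
  then show ?thesis using assms by simp
qed

lemma continuous_on_lipschitz_comp:
  assumes "L-lipschitz_on UNIV g" "continuous_on X A"
  shows "continuous_on X (\<lambda>t. g (A t))"
  using continuous_on_compose2[OF lipschitz_on_continuous_on[OF assms(1)] assms(2)] by simp

lemma continuous_on_picard_integrand:
  assumes "1-lipschitz_on UNIV h" "L-lipschitz_on UNIV g" "continuous_on {a..b} A"
  shows "continuous_on {a..b} (\<lambda>s. h (- avg (\<lambda>t. g (A t)) s))"
  by (rule continuous_on_lipschitz_comp[OF assms(1)], rule continuous_on_minus,
      rule continuous_on_avg, rule continuous_on_lipschitz_comp[OF assms(2,3)])

lemma continuous_on_picard:
  assumes "1-lipschitz_on UNIV h" "L-lipschitz_on UNIV g" "continuous_on {a..b} A"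
  shows "continuous_on {a..b} (picard h g A)"
  unfolding picard_def
  by (rule continuous_on_add, rule continuous_on_const, rule indefinite_integral_continuous_1,
      rule integrable_continuous_real, rule continuous_on_picard_integrand[OF assms])

text \<open>Two integrations of \<open>exp (\<mu> * (t - a))\<close> gain the factor \<open>1 / \<mu>\<^sup>2\<close>. In the norm weighted by this
  exponential the operator is therefore a contraction on the whole interval once \<open>\<mu>\<close> is large.\<close>

lemma picard_contraction:
  assumes h: "1-lipschitz_on UNIV h" and g: "L-lipschitz_on UNIV g"
    and A: "continuous_on {a..b} A" and B: "continuous_on {a..b} B"
    and S: "S \<ge> 0" and \<mu>: "\<mu> > 0"
    and le: "\<And>t. t \<in> {a..b} \<Longrightarrow> \<bar>A t - B t\<bar> \<le> S * exp (\<mu> * (t - a))"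
    and r: "r \<in> {a..b}"
  shows "\<bar>picard h g A r - picard h g B r\<bar> \<le> L / \<mu>\<^sup>2 * S * exp (\<mu> * (r - a))"
proof -
  have L: "L \<ge> 0" using g by (rule lipschitz_on_nonneg)
  have cA: "continuous_on {a..b} (\<lambda>t. g (A t))" and cB: "continuous_on {a..b} (\<lambda>t. g (B t))"
    using A B g by (auto intro: continuous_on_lipschitz_comp)
  have 1: "\<bar>h (- avg (\<lambda>t. g (A t)) s) - h (- avg (\<lambda>t. g (B t)) s)\<bar> \<le> L * S / \<mu> * exp (\<mu> * (s - a))"
    if s: "s \<in> {a..b}" for s
  proof -
    have "\<bar>h (- avg (\<lambda>t. g (A t)) s) - h (- avg (\<lambda>t. g (B t)) s)\<bar>
        \<le> \<bar>avg (\<lambda>t. g (A t)) s - avg (\<lambda>t. g (B t)) s\<bar>"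
      using lipschitz_onD[OF h, of "- avg (\<lambda>t. g (A t)) s" "- avg (\<lambda>t. g (B t)) s"]
      by (simp add: dist_real_def)
    also have "\<dots> = \<bar>avg (\<lambda>t. g (A t) - g (B t)) s\<bar>"
      by (simp add: avg_diff[OF cA cB s])
    also have "\<dots> \<le> integral {a..s} (\<lambda>t. (L * S) * exp (\<mu> * (t - a)))"
    proof (rule abs_avg_le)
      fix t assume "t \<in> {a..s}"
      then have t: "t \<in> {a..b}" using s by auto
      have "\<bar>g (A t) - g (B t)\<bar> \<le> L * \<bar>A t - B t\<bar>"
        using lipschitz_onD[OF g, of "A t" "B t"] by (simp add: dist_real_def)
      also have "\<dots> \<le> L * (S * exp (\<mu> * (t - a)))"
        by (rule mult_left_mono[OF le[OF t] L])
      finally show "\<bar>g (A t) - g (B t)\<bar> \<le> L * S * exp (\<mu> * (t - a))" by (simp add: mult.assoc)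
    qed (use s cA cB in \<open>auto intro!: continuous_intros\<close>)
    also have "\<dots> \<le> L * S * exp (\<mu> * (s - a)) / \<mu>"
      by (rule integral_exp_le) (use L S \<mu> s in auto)
    finally show ?thesis by simp
  qed
  have sub: "continuous_on {a..r} (\<lambda>s. h (- avg (\<lambda>t. g (A t)) s))"
      "continuous_on {a..r} (\<lambda>s. h (- avg (\<lambda>t. g (B t)) s))"
    using continuous_on_picard_integrand[OF h g A] continuous_on_picard_integrand[OF h g B] r
    by (auto elim: continuous_on_subset)
  have "picard h g A r - picard h g B r
      = integral {a..r} (\<lambda>s. h (- avg (\<lambda>t. g (A t)) s) - h (- avg (\<lambda>t. g (B t)) s))"
    by (simp add: picard_def integral_diff[OF integrable_continuous_real[OF sub(1)] integrable_continuous_real[OF sub(2)]])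
  also have "norm \<dots> \<le> integral {a..r} (\<lambda>s. L * S / \<mu> * exp (\<mu> * (s - a)))"
    by (rule integral_norm_bound_integral)
      (use sub r 1 in \<open>auto intro!: integrable_continuous_real continuous_intros simp del: times_divide_eq_left\<close>)
  also have "\<dots> \<le> L * S / \<mu> * exp (\<mu> * (r - a)) / \<mu>"
    by (rule integral_exp_le) (use L S \<mu> r in auto)
  finally show ?thesis by (simp add: power2_eq_square)
qed

text \<open>The choice \<open>\<mu> = sqrt (2 * L)\<close> makes the contraction factor \<open>1 / 2\<close>.\<close>

lemma picard_half_contraction:
  assumes "1-lipschitz_on UNIV h" "L-lipschitz_on UNIV g" "L > 0"
    and "continuous_on {a..b} A" "continuous_on {a..b} B" "S \<ge> 0"
    and "\<And>t. t \<in> {a..b} \<Longrightarrow> \<bar>A t - B t\<bar> \<le> S * exp (sqrt (2 * L) * (t - a))"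
    and "r \<in> {a..b}"
  shows "\<bar>picard h g A r - picard h g B r\<bar> \<le> S / 2 * exp (sqrt (2 * L) * (r - a))"
  using picard_contraction[OF assms(1,2,4,5,6) _ assms(7,8)] assms(3) by simp

text \<open>The usual a posteriori estimate for contractions: the weighted distance \<open>D\<close> of \<open>A\<close> and \<open>B\<close>
  satisfies \<open>D \<le> D / 2 + \<delta>\<close>. The case \<open>\<delta> = 0\<close> gives uniqueness; small \<open>\<delta>\<close> gives continuous
  dependence on parameters.\<close>

lemma picard_near_fixed_point:
  assumes h: "1-lipschitz_on UNIV h" and g: "L-lipschitz_on UNIV g" and L: "L > 0"
    and A: "continuous_on {a..b} A" and B: "continuous_on {a..b} B"
    and fA: "\<And>r. r \<in> {a..b} \<Longrightarrow> picard h g A r = A r"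
    and fB: "\<And>r. r \<in> {a..b} \<Longrightarrow> \<bar>picard h g B r - B r\<bar> \<le> \<delta>"
    and r: "r \<in> {a..b}"
  shows "\<bar>A r - B r\<bar> \<le> 2 * exp (sqrt (2 * L) * (b - a)) * \<delta>"
proof -
  define \<mu> where "\<mu> = sqrt (2 * L)"
  have \<mu>: "\<mu> > 0" using L by (simp add: \<mu>_def)
  define D where "D t = \<bar>A t - B t\<bar> * exp (- \<mu> * (t - a))" for t
  have "continuous_on {a..b} D"
    unfolding D_def using A B by (intro continuous_intros)
  then obtain r0 where r0: "r0 \<in> {a..b}" and max: "\<And>t. t \<in> {a..b} \<Longrightarrow> D t \<le> D r0"
    using continuous_attains_sup[of "{a..b}" D] a_less_b by auto
  have D0: "D r0 \<ge> 0" by (simp add: D_def)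
  have D_iff: "\<bar>A t - B t\<bar> = D t * exp (\<mu> * (t - a))" for t
  proof -
    have "exp (- \<mu> * (t - a)) * exp (\<mu> * (t - a)) = 1"
      by (simp flip: exp_add)
    then show ?thesis by (simp add: D_def mult.assoc)
  qed
  have \<delta>: "\<delta> \<ge> 0" using fB[OF r] by linarith
  have "\<bar>picard h g A r0 - picard h g B r0\<bar> \<le> D r0 / 2 * exp (\<mu> * (r0 - a))"
    unfolding \<mu>_def
    by (rule picard_half_contraction[OF h g L A B D0 _ r0])
      (use max D_iff in \<open>auto simp flip: \<mu>_def intro!: mult_right_mono\<close>)
  with fA[OF r0] fB[OF r0]
  have "D r0 * exp (\<mu> * (r0 - a)) \<le> D r0 / 2 * exp (\<mu> * (r0 - a)) + \<delta>"
    unfolding D_iff[symmetric] by linarith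
  then have "D r0 / 2 * exp (\<mu> * (r0 - a)) \<le> \<delta>" by linarith
  moreover have "D r0 / 2 * 1 \<le> D r0 / 2 * exp (\<mu> * (r0 - a))"
    by (rule mult_left_mono) (use \<mu> r0 D0 in auto)
  ultimately have "D r0 \<le> 2 * \<delta>" by linarith
  with max[OF r] have "D r \<le> 2 * \<delta>" by linarith
  then have "D r * exp (\<mu> * (r - a)) \<le> 2 * \<delta> * exp (\<mu> * (b - a))"
    by (intro mult_mono) (use \<delta> \<mu> r in auto)
  then show ?thesis by (simp add: D_iff \<mu>_def mult_ac)
qed

text \<open>Banach's theorem in the space of bounded continuous functions on the line. The unknown
  \<open>W\<close> is the solution divided by the exponential weight; the image under the operator is
  extended to the line by constants outside the interval.\<close>

lemma picard_fixed_point_exists: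
  assumes h: "1-lipschitz_on UNIV h" and g: "L-lipschitz_on UNIV g" and L: "L > 0"
  shows "\<exists>A. continuous_on {a..b} A \<and> (\<forall>r\<in>{a..b}. A r = picard h g A r)"
proof -
  define \<mu> where "\<mu> = sqrt (2 * L)"
  define unw :: "(real \<Rightarrow>\<^sub>C real) \<Rightarrow> real \<Rightarrow> real"
    where "unw W t = exp (\<mu> * (t - a)) * apply_bcontfun W t" for W t
  have cu: "continuous_on {a..b} (unw W)" for W
    unfolding unw_def by (intro continuous_intros) simp
  have "\<exists>V :: real \<Rightarrow>\<^sub>C real. (\<forall>t\<in>{a..b}. apply_bcontfun V t = exp (- \<mu> * (t - a)) * picard h g (unw W) t)
      \<and> (\<forall>t. \<exists>s\<in>{a..b}. apply_bcontfun V t = exp (- \<mu> * (s - a)) * picard h g (unw W) s \<and> s = clamp a b t)" for W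
  proof -
    have "continuous_on (cbox a b) (\<lambda>t. exp (- \<mu> * (t - a)) * picard h g (unw W) t)"
      unfolding cbox_interval by (intro continuous_intros continuous_on_picard[OF h g cu])
    then obtain V :: "real \<Rightarrow>\<^sub>C real" where
      "\<And>t. t \<in> cbox a b \<Longrightarrow> apply_bcontfun V t = exp (- \<mu> * (t - a)) * picard h g (unw W) t"
      "\<And>t. apply_bcontfun V t = exp (- \<mu> * (clamp a b t - a)) * picard h g (unw W) (clamp a b t)"
      by (rule continuous_on_cbox_bcontfunE) (rule that)
    moreover have "clamp a b t \<in> {a..b}" for t
      using clamp_in_interval[of a b t] a_less_b by (simp add: cbox_interval)
    ultimately show ?thesis by (intro exI[of _ V]) (auto simp: cbox_interval)
  qed
  then obtain T :: "(real \<Rightarrow>\<^sub>C real) \<Rightarrow> (real \<Rightarrow>\<^sub>C real)" where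
    T1: "\<And>W t. t \<in> {a..b} \<Longrightarrow> apply_bcontfun (T W) t = exp (- \<mu> * (t - a)) * picard h g (unw W) t"
    and T2: "\<And>W t. \<exists>s\<in>{a..b}. apply_bcontfun (T W) t = exp (- \<mu> * (s - a)) * picard h g (unw W) s \<and> s = clamp a b t"
    by metis
  have "\<exists>!W. T W = W"
  proof (rule banach_fix_type[of "1/2"], simp, simp, intro allI)
    fix V W
    show "dist (T V) (T W) \<le> 1/2 * dist V W"
    proof (rule dist_bound)
      fix t
      obtain s where s: "s \<in> {a..b}"
        and V: "apply_bcontfun (T V) t = exp (- \<mu> * (s - a)) * picard h g (unw V) s"
        and W: "apply_bcontfun (T W) t = exp (- \<mu> * (s - a)) * picard h g (unw W) s"
        using T2[where W = V and t = t] T2[where W = W and t = t] by auto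
      have "\<bar>picard h g (unw V) s - picard h g (unw W) s\<bar> \<le> dist V W / 2 * exp (\<mu> * (s - a))"
        unfolding \<mu>_def
      proof (rule picard_half_contraction[OF h g L cu cu _ _ s])
        fix t
        have "\<bar>unw V t - unw W t\<bar> = exp (\<mu> * (t - a)) * \<bar>apply_bcontfun V t - apply_bcontfun W t\<bar>"
          by (simp add: unw_def abs_mult flip: right_diff_distrib)
        also have "\<dots> \<le> exp (\<mu> * (t - a)) * dist V W"
          using dist_bounded[of V t W] by (simp add: dist_real_def)
        finally show "\<bar>unw V t - unw W t\<bar> \<le> dist V W * exp (sqrt (2 * L) * (t - a))"
          by (simp add: \<mu>_def mult.commute)
      qed simp
      then have "exp (- \<mu> * (s - a)) * \<bar>picard h g (unw V) s - picard h g (unw W) s\<bar>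
          \<le> exp (- \<mu> * (s - a)) * (dist V W / 2 * exp (\<mu> * (s - a)))"
        by (intro mult_left_mono) auto
      also have "\<dots> = dist V W / 2"
      proof -
        have "exp (- \<mu> * (s - a)) * exp (\<mu> * (s - a)) = 1" by (simp flip: exp_add)
        then show ?thesis by (simp add: field_simps)
      qed
      finally show "dist (apply_bcontfun (T V) t) (apply_bcontfun (T W) t) \<le> 1/2 * dist V W"
        by (simp add: V W dist_real_def abs_mult flip: right_diff_distrib)
    qed
  qed
  then obtain W where W: "T W = W" by auto
  have "unw W t = picard h g (unw W) t" if "t \<in> {a..b}" for t
  proof -
    have "unw W t = exp (\<mu> * (t - a)) * (exp (- \<mu> * (t - a)) * picard h g (unw W) t)"
      using T1[OF that, of W] by (simp add: W unw_def)
    also have "\<dots> = picard h g (unw W) t"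
      by (simp flip: exp_add mult.assoc)
    finally show ?thesis .
  qed
  with cu show ?thesis by blast
qed

end

section \<open>Solutions and their polar angle\<close>

context radial_interval begin

definition solves :: "(real \<Rightarrow> real) \<Rightarrow> (real \<Rightarrow> real) \<Rightarrow> (real \<Rightarrow> real) \<Rightarrow> bool" where
  "solves h g A \<longleftrightarrow> continuous_on {a..b} A \<and> (\<forall>r\<in>{a..b}. A r = picard h g A r)"

definition flux :: "(real \<Rightarrow> real) \<Rightarrow> (real \<Rightarrow> real) \<Rightarrow> real \<Rightarrow> real" where
  "flux g A r = - avg (\<lambda>t. g (A t)) r"

definition momentum :: "(real \<Rightarrow> real) \<Rightarrow> (real \<Rightarrow> real) \<Rightarrow> real \<Rightarrow> real" where
  "momentum g A r = r ^ m * flux g A r"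

lemma solves_exists:
  assumes "1-lipschitz_on UNIV h" "L-lipschitz_on UNIV g" "L > 0"
  shows "\<exists>A. solves h g A"
  using picard_fixed_point_exists[OF assms] by (simp add: solves_def)

lemma solves_unique:
  assumes "1-lipschitz_on UNIV h" "L-lipschitz_on UNIV g" "L > 0"
    and "solves h g A" "solves h g B" "r \<in> {a..b}"
  shows "A r = B r"
  using picard_near_fixed_point[OF assms(1-3), of A B 0 r] assms(4-6) by (auto simp: solves_def)

lemma solves_left_end: "solves h g A \<Longrightarrow> A a = 1"
  using a_less_b by (auto simp: solves_def picard_def)

lemma flux_left_end [simp]: "flux g A a = 0"
  by (simp add: flux_def)

lemma momentum_left_end [simp]: "momentum g A a = 0"
  by (simp add: momentum_def)

end

locale radial_solution = radial_interval +
  fixes h g :: "real \<Rightarrow> real" and L :: real and A :: "real \<Rightarrow> real"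
  assumes h_lip: "1-lipschitz_on UNIV h" and g_lip: "L-lipschitz_on UNIV g" and L_pos: "L > 0"
    and h_0: "h 0 = 0"
    and solves: "solves h g A"
begin

abbreviation "P \<equiv> flux g A"
abbreviation "B \<equiv> momentum g A"

lemma cont_A: "continuous_on {a..b} A"
  using solves by (simp add: solves_def)

lemma A_left_end [simp]: "A a = 1"
  by (rule solves_left_end[OF solves])

lemma cont_gA: "continuous_on {a..b} (\<lambda>t. g (A t))"
  by (rule continuous_on_lipschitz_comp[OF g_lip cont_A])

lemma cont_P: "continuous_on {a..b} P"
  using continuous_on_minus[OF continuous_on_avg[OF cont_gA]] by (simp add: flux_def[abs_def])

lemma cont_B: "continuous_on {a..b} B"
  unfolding momentum_def by (intro continuous_intros cont_P)

lemma h_le: "\<bar>h x\<bar> \<le> \<bar>x\<bar>"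
  using lipschitz_onD[OF h_lip, of x 0] by (simp add: dist_real_def h_0)

lemma cont_hP: "continuous_on {a..b} (\<lambda>t. h (P t))"
  by (rule continuous_on_lipschitz_comp[OF h_lip cont_P])

lemma A_deriv_within:
  assumes "r \<in> {a..b}"
  shows "(A has_real_derivative h (P r)) (at r within {a..b})"
proof (rule has_field_derivative_transform_within[OF _ zero_less_one assms])
  show "((\<lambda>r. 1 + integral {a..r} (\<lambda>s. h (P s))) has_real_derivative h (P r)) (at r within {a..b})"
    using DERIV_add[OF DERIV_const[of 1] integral_has_real_derivative[OF cont_hP assms]] by simp
qed (use solves in \<open>auto simp: solves_def picard_def flux_def\<close>)

lemma B_deriv_within:
  assumes "r \<in> {a..b}"
  shows "(B has_real_derivative - (r ^ m * g (A r))) (at r within {a..b})"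
proof (rule has_field_derivative_transform_within[OF _ zero_less_one assms])
  show "((\<lambda>r. - integral {a..r} (\<lambda>s. s ^ m * g (A s))) has_real_derivative - (r ^ m * g (A r)))
      (at r within {a..b})"
    by (intro DERIV_minus integral_has_real_derivative continuous_intros cont_gA assms)
  show "- integral {a..x} (\<lambda>s. s ^ m * g (A s)) = B x" if "x \<in> {a..b}" for x
    using that power_times_avg[of x "\<lambda>s. g (A s)"] by (simp add: momentum_def flux_def)
qed

lemma A_deriv: "r \<in> {a<..<b} \<Longrightarrow> (A has_real_derivative h (P r)) (at r)"
  using A_deriv_within[of r] by (simp add: at_within_Icc_at)

lemma B_deriv: "r \<in> {a<..<b} \<Longrightarrow> (B has_real_derivative - (r ^ m * g (A r))) (at r)"
  using B_deriv_within[of r] by (simp add: at_within_Icc_at)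

text \<open>A constant \<open>c\<close> with \<open>g c = 0\<close> and zero flux is a rest point. A solution that meets it at
  some \<open>r0 > a\<close> is equal to it on the left of \<open>r0\<close>, because \<open>(A - c)\<^sup>2 + B\<^sup>2\<close> obeys a Gronwall
  inequality on every interval \<open>[r1, r0]\<close> with \<open>r1 > 0\<close>. The value \<open>1\<close> at the left end then
  forces \<open>c = 1\<close>.\<close>

lemma equilibrium_unreachable:
  assumes c: "g c = 0" and r0: "r0 \<in> {a<..b}" and A0: "A r0 = c" and P0: "P r0 = 0"
  shows "c = 1"
proof -
  have const: "A r1 = c" if r1: "r1 \<in> {a<..<r0}" for r1
  proof -
    have r1_pos: "r1 > 0" using r1 a_nonneg by simp
    \<comment> \<open>the factors in \<open>\<bar>A'\<bar> \<le> \<bar>B\<bar> / r1 ^ m\<close> and \<open>\<bar>B'\<bar> \<le> b ^ m * L * \<bar>A - c\<bar>\<close>\<close>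
    define C where "C = 1 / r1 ^ m + b ^ m * L"
    define E where "E r = ((A r - c)\<^sup>2 + (B r)\<^sup>2) * exp (C * r)" for r
    have "E r1 \<le> E r0"
    proof (rule DERIV_nonneg_imp_increasing_open[where f = E])
      show "r1 \<le> r0" using r1 by simp
      show "continuous_on {r1..r0} E"
        unfolding E_def using r0 r1
        by (intro continuous_intros continuous_on_subset[OF cont_A] continuous_on_subset[OF cont_B]) auto
      fix r assume r: "r1 < r" "r < r0"
      then have rab: "r \<in> {a<..<b}" and r_pos: "r > 0" using r0 r1 a_nonneg by auto
      have "(E has_real_derivative (2 * (A r - c) * h (P r) - 2 * B r * (r ^ m * g (A r))
          + C * ((A r - c)\<^sup>2 + (B r)\<^sup>2)) * exp (C * r)) (at r)"
        unfolding E_def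
        by (rule derivative_eq_intros refl A_deriv[OF rab] B_deriv[OF rab])+
          (simp add: algebra_simps)
      moreover have "2 * (A r - c) * h (P r) - 2 * B r * (r ^ m * g (A r))
          + C * ((A r - c)\<^sup>2 + (B r)\<^sup>2) \<ge> 0"
      proof -
        have "\<bar>h (P r)\<bar> \<le> \<bar>P r\<bar>" by (rule h_le)
        also have "\<dots> = \<bar>B r\<bar> / r ^ m" using r_pos by (simp add: momentum_def abs_mult)
        also have "\<dots> \<le> \<bar>B r\<bar> / r1 ^ m"
          using r r1_pos by (intro divide_left_mono power_mono) auto
        finally have 1: "\<bar>h (P r)\<bar> \<le> 1 / r1 ^ m * \<bar>B r\<bar>" by simp
        have "\<bar>g (A r)\<bar> \<le> L * \<bar>A r - c\<bar>"
          using lipschitz_onD[OF g_lip, of "A r" c] c by (simp add: dist_real_def)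
        moreover have "r ^ m \<le> b ^ m" using rab r_pos by (intro power_mono) auto
        ultimately have "\<bar>r ^ m * g (A r)\<bar> \<le> b ^ m * (L * \<bar>A r - c\<bar>)"
          unfolding abs_mult using r_pos a_nonneg a_less_b by (intro mult_mono) (auto simp: power_abs)
        then have 2: "\<bar>r ^ m * g (A r)\<bar> \<le> b ^ m * L * \<bar>A r - c\<bar>" by (simp add: mult.assoc)
        have "\<bar>(A r - c) * h (P r) - B r * (r ^ m * g (A r))\<bar>
            \<le> \<bar>A r - c\<bar> * \<bar>h (P r)\<bar> + \<bar>B r\<bar> * \<bar>r ^ m * g (A r)\<bar>"
          by (metis abs_triangle_ineq4 abs_mult)
        also have "\<dots> \<le> \<bar>A r - c\<bar> * (1 / r1 ^ m * \<bar>B r\<bar>) + \<bar>B r\<bar> * (b ^ m * L * \<bar>A r - c\<bar>)"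
          by (intro add_mono mult_left_mono 1 2) auto
        also have "\<dots> = C * (\<bar>A r - c\<bar> * \<bar>B r\<bar>)" by (simp add: C_def algebra_simps)
        finally have "\<bar>2 * ((A r - c) * h (P r) - B r * (r ^ m * g (A r)))\<bar>
            \<le> C * (2 * \<bar>A r - c\<bar> * \<bar>B r\<bar>)" unfolding abs_mult by simp
        also have "\<dots> \<le> C * ((A r - c)\<^sup>2 + (B r)\<^sup>2)"
          using sum_squares_bound[of "\<bar>A r - c\<bar>" "\<bar>B r\<bar>"] r1_pos L_pos a_nonneg a_less_b
          by (intro mult_left_mono) (auto simp: C_def)
        finally show ?thesis by (simp add: algebra_simps abs_le_iff)
      qed
      ultimately show "\<exists>y. (E has_real_derivative y) (at r) \<and> 0 \<le> y"
        by (metis mult_nonneg_nonneg exp_ge_zero)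
    qed
    also have "E r0 = 0" by (simp add: E_def A0 momentum_def P0)
    finally have "(A r1 - c)\<^sup>2 + (B r1)\<^sup>2 \<le> 0" by (simp add: E_def mult_le_0_iff)
    then show ?thesis by (smt (verit) zero_le_power2 power2_eq_iff zero_eq_power2)
  qed
  have "(A \<longlongrightarrow> A a) (at a within {a..b})"
    using cont_A a_less_b unfolding continuous_on_def by (metis atLeastAtMost_iff less_imp_le order_refl)
  then have "(A \<longlongrightarrow> 1) (at_right a)"
    using a_less_b by (simp add: at_within_Icc_at_right)
  moreover have "\<forall>\<^sub>F r in at_right a. A r = c"
    using r0 const by (auto simp: eventually_at_right intro!: exI[of _ r0])
  then have "(A \<longlongrightarrow> c) (at_right a)" by (rule tendsto_eventually)
  ultimately show "c = 1"
    by (meson tendsto_unique trivial_limit_at_right_real)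
qed

end

locale oscillating_solution = radial_solution +
  assumes g_0: "g 0 = 0"
begin

lemma nonvanishing:
  assumes r: "r \<in> {a..b}"
  shows "(A r)\<^sup>2 + (B r)\<^sup>2 > 0"
proof (rule ccontr)
  assume "\<not> ?thesis"
  then have "A r = 0" "B r = 0" by (auto simp: sum_power2_gt_zero_iff)
  moreover from this have "r > a" using r by (cases "r = a") auto
  moreover from this have "P r = 0" using \<open>B r = 0\<close> a_nonneg by (simp add: momentum_def)
  ultimately show False using equilibrium_unreachable[of 0 r] r g_0 by simp
qed

text \<open>The derivative of the clockwise polar angle of the point \<open>(A, B)\<close>. Defining the angle as the
  integral of this quotient avoids lifting arguments and makes its dependence on parameters
  a matter of continuity of the integrand.\<close>

definition spin :: "real \<Rightarrow> real" where
  "spin r = (A r * (r ^ m * g (A r)) + B r * h (P r)) / ((A r)\<^sup>2 + (B r)\<^sup>2)"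

definition angle :: "real \<Rightarrow> real" where
  "angle r = integral {a..r} spin"

lemma cont_spin: "continuous_on {a..b} spin"
  unfolding spin_def
  by (intro continuous_intros cont_A cont_B cont_gA cont_hP) (use nonvanishing in force)

lemma angle_left_end [simp]: "angle a = 0"
  by (simp add: angle_def)

lemma angle_deriv_within:
  "r \<in> {a..b} \<Longrightarrow> (angle has_real_derivative spin r) (at r within {a..b})"
  unfolding angle_def by (rule integral_has_real_derivative[OF cont_spin])

lemma angle_deriv: "r \<in> {a<..<b} \<Longrightarrow> (angle has_real_derivative spin r) (at r)"
  using angle_deriv_within[of r] by (simp add: at_within_Icc_at)

lemma cont_angle: "continuous_on {a..b} angle"
  using angle_deriv_within by (meson DERIV_continuous_on)

text \<open>In the frame that turns with the angle, the point has coordinates \<open>(Y, X)\<close>. The choice of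
  \<open>spin\<close> makes \<open>X\<^sup>2 / (A\<^sup>2 + B\<^sup>2)\<close> constant; it vanishes at the left end. Hence \<open>X = 0\<close>, and \<open>Y\<close>,
  which starts at \<open>1\<close>, never vanishes and stays positive.\<close>

lemma polar:
  assumes r: "r \<in> {a..b}"
  obtains \<rho> where "\<rho> > 0" "A r = \<rho> * cos (angle r)" "B r = - \<rho> * sin (angle r)"
proof -
  define X where "X r = A r * sin (angle r) + B r * cos (angle r)" for r
  define Y where "Y r = A r * cos (angle r) - B r * sin (angle r)" for r
  have cX: "continuous_on {a..b} X" and cY: "continuous_on {a..b} Y"
    unfolding X_def Y_def by (intro continuous_intros cont_A cont_B cont_angle)+
  have AXY: "A r = X r * sin (angle r) + Y r * cos (angle r)" for r
  proof -
    have "X r * sin (angle r) + Y r * cos (angle r) = A r * ((sin (angle r))\<^sup>2 + (cos (angle r))\<^sup>2)"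
      unfolding X_def Y_def by algebra
    then show ?thesis by simp
  qed
  have BXY: "B r = X r * cos (angle r) - Y r * sin (angle r)" for r
  proof -
    have "X r * cos (angle r) - Y r * sin (angle r) = B r * ((sin (angle r))\<^sup>2 + (cos (angle r))\<^sup>2)"
      unfolding X_def Y_def by algebra
    then show ?thesis by simp
  qed
  have XY: "(X r)\<^sup>2 + (Y r)\<^sup>2 = (A r)\<^sup>2 + (B r)\<^sup>2" for r
  proof -
    have "(X r)\<^sup>2 + (Y r)\<^sup>2 = ((A r)\<^sup>2 + (B r)\<^sup>2) * ((sin (angle r))\<^sup>2 + (cos (angle r))\<^sup>2)"
      unfolding X_def Y_def by algebra
    then show ?thesis by simp
  qed
  define Q where "Q r = (X r)\<^sup>2 / ((A r)\<^sup>2 + (B r)\<^sup>2)" for r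
  have cQ: "continuous_on {a..b} Q"
    unfolding Q_def by (intro continuous_intros cX cont_A cont_B) (use nonvanishing in force)
  have dQ: "(Q has_real_derivative 0) (at s)" if s: "s \<in> {a<..<b}" for s
  proof -
    have nz: "(A s)\<^sup>2 + (B s)\<^sup>2 \<noteq> 0" using nonvanishing[of s] s by auto
    define A' B' where "A' = h (P s)" and "B' = - (s ^ m * g (A s))"
    define u v where "u = sin (angle s)" and "v = cos (angle s)"
    have uv: "u * u + v * v = 1" by (simp add: u_def v_def flip: power2_eq_square)
    have sp: "spin s * ((A s)\<^sup>2 + (B s)\<^sup>2) = B s * A' - A s * B'"
      using nz by (simp add: spin_def A'_def B'_def)
    have dX: "(X has_real_derivative (A' * u + B' * v + spin s * Y s)) (at s)"
      unfolding X_def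
      by (rule derivative_eq_intros refl A_deriv[OF s] B_deriv[OF s] angle_deriv[OF s])+
        (simp add: A'_def B'_def u_def v_def Y_def algebra_simps)
    have "(Q has_real_derivative (2 * X s * (A' * u + B' * v + spin s * Y s) * ((A s)\<^sup>2 + (B s)\<^sup>2)
        - (X s)\<^sup>2 * (2 * A s * A' + 2 * B s * B')) / ((A s)\<^sup>2 + (B s)\<^sup>2)\<^sup>2) (at s)"
      unfolding Q_def
      by (rule derivative_eq_intros refl dX A_deriv[OF s] B_deriv[OF s] nz)+
        (simp add: A'_def B'_def power2_eq_square)
    moreover have "2 * X s * (A' * u + B' * v + spin s * Y s) * ((A s)\<^sup>2 + (B s)\<^sup>2)
        - (X s)\<^sup>2 * (2 * A s * A' + 2 * B s * B')
      = 2 * X s * ((A' * u + B' * v) * ((X s)\<^sup>2 + (Y s)\<^sup>2) + (B s * A' - A s * B') * Y s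
          - X s * (A s * A' + B s * B'))"
      unfolding XY sp[symmetric] by (simp add: algebra_simps power2_eq_square)
    moreover have "(A' * u + B' * v) * ((X s)\<^sup>2 + (Y s)\<^sup>2) + (B s * A' - A s * B') * Y s
          - X s * (A s * A' + B s * B') = 0"
      using AXY[of s] BXY[of s] unfolding u_def[symmetric] v_def[symmetric]
      by algebra
    ultimately show ?thesis by simp
  qed
  have X0: "X s = 0" if s: "s \<in> {a..b}" for s
  proof (cases "s = a")
    case True
    then show ?thesis by (simp add: X_def)
  next
    case False
    then have "Q s = Q a"
      using s by (intro DERIV_isconst_end continuous_on_subset[OF cQ] dQ) auto
    also have "\<dots> = 0" by (simp add: Q_def X_def)
    finally show ?thesis using nonvanishing[OF s] by (auto simp: Q_def)
  qed
  have Y_pos: "Y r > 0"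
  proof (rule ccontr)
    assume "\<not> Y r > 0"
    moreover have "Y a = 1" by (simp add: Y_def)
    ultimately have "\<exists>s\<ge>a. s \<le> r \<and> Y s = 0"
      using r by (intro IVT2' continuous_on_subset[OF cY]) auto
    then obtain s where "a \<le> s" "s \<le> r" "Y s = 0" by auto
    moreover from this have "s \<in> {a..b}" using r by auto
    ultimately show False using XY[of s] X0[of s] nonvanishing[of s] by simp
  qed
  from that[OF Y_pos] show thesis using AXY[of r] BXY[of r] X0[OF r] by simp
qed

end

section \<open>Continuous dependence on a parameter\<close>

text \<open>This is the tube lemma: the interval is compact.\<close>

lemma (in radial_interval) eventually_uniformly_close:
  fixes \<phi> :: "real \<Rightarrow> real \<Rightarrow> real"
  assumes "continuous_on (S \<times> {a..b}) (\<lambda>(e, t). \<phi> e t)" "e0 \<in> S" "\<eta> > 0"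
  shows "\<forall>\<^sub>F e in at e0 within S. \<forall>t\<in>{a..b}. \<bar>\<phi> e t - \<phi> e0 t\<bar> \<le> \<eta>"
proof -
  obtain X where X: "e0 \<in> X" "open X"
    "\<forall>e\<in>X \<inter> S. \<forall>t\<in>{a..b}. dist (case (e, t) of (e, t) \<Rightarrow> \<phi> e t) (case (e0, t) of (e, t) \<Rightarrow> \<phi> e t) \<le> \<eta>"
    by (rule continuous_on_prod_compactE[OF assms(1) compact_Icc assms(2,3)])
  then show ?thesis
    by (auto simp: eventually_at_topological dist_real_def intro!: exI[of _ X])
qed

lemma (in radial_interval) jointly_continuous:
  fixes \<phi> :: "real \<Rightarrow> real \<Rightarrow> real"
  assumes cont: "\<And>e. e \<in> S \<Longrightarrow> continuous_on {a..b} (\<phi> e)"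
    and unif: "\<And>e0 \<eta>. e0 \<in> S \<Longrightarrow> \<eta> > 0 \<Longrightarrow>
      \<forall>\<^sub>F e in at e0 within S. \<forall>t\<in>{a..b}. \<bar>\<phi> e t - \<phi> e0 t\<bar> \<le> \<eta>"
  shows "continuous_on (S \<times> {a..b}) (\<lambda>(e, t). \<phi> e t)"
  unfolding continuous_on_iff
proof (intro ballI allI impI)
  fix z and \<eta> :: real assume z: "z \<in> S \<times> {a..b}" and \<eta>: "0 < \<eta>"
  obtain e0 t0 where z_eq: "z = (e0, t0)" and e0: "e0 \<in> S" and t0: "t0 \<in> {a..b}" using z by auto
  have \<eta>3: "\<eta> / 3 > 0" using \<eta> by simp
  obtain d1 where d1: "d1 > 0"
    "\<forall>e\<in>S. e \<noteq> e0 \<and> dist e e0 < d1 \<longrightarrow> (\<forall>t\<in>{a..b}. \<bar>\<phi> e t - \<phi> e0 t\<bar> \<le> \<eta> / 3)"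
    using unif[OF e0 \<eta>3] unfolding eventually_at by blast
  obtain d2 where d2: "d2 > 0" "\<forall>t\<in>{a..b}. dist t t0 < d2 \<longrightarrow> dist (\<phi> e0 t) (\<phi> e0 t0) < \<eta> / 3"
    using cont[OF e0] t0 \<eta>3 unfolding continuous_on_iff by blast
  show "\<exists>d>0. \<forall>x'\<in>S \<times> {a..b}. dist x' z < d \<longrightarrow>
      dist (case x' of (e, t) \<Rightarrow> \<phi> e t) (case z of (e, t) \<Rightarrow> \<phi> e t) < \<eta>"
  proof (intro exI[of _ "min d1 d2"] conjI ballI impI)
    fix x' assume x': "x' \<in> S \<times> {a..b}" "dist x' z < min d1 d2"
    obtain e t where x'_eq: "x' = (e, t)" and e: "e \<in> S" and t: "t \<in> {a..b}" using x' by auto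
    have "dist e e0 \<le> dist x' z" "dist t t0 \<le> dist x' z"
      using dist_fst_le[of x' z] dist_snd_le[of x' z] by (simp_all add: x'_eq z_eq)
    then have de: "dist e e0 < d1" and dt: "dist t t0 < d2" using x' by auto
    have "\<bar>\<phi> e t - \<phi> e0 t\<bar> \<le> \<eta> / 3"
      using d1(2) e de t \<eta> by (cases "e = e0") auto
    moreover have "dist (\<phi> e0 t) (\<phi> e0 t0) < \<eta> / 3" using d2(2) t dt by blast
    ultimately have "dist (\<phi> e t) (\<phi> e0 t0) < \<eta>"
      unfolding dist_real_def using \<eta> by linarith
    then show "dist (case x' of (e, t) \<Rightarrow> \<phi> e t) (case z of (e, t) \<Rightarrow> \<phi> e t) < \<eta>"
      by (simp add: x'_eq z_eq)
  qed (use d1 d2 in auto)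
qed

locale oscillating_family = radial_interval +
  fixes S :: "real set" and h g :: "real \<Rightarrow> real \<Rightarrow> real" and L :: real and A :: "real \<Rightarrow> real \<Rightarrow> real"
  assumes solution: "e \<in> S \<Longrightarrow> oscillating_solution m a b (h e) (g e) L (A e)"
    and cont_h: "continuous_on (S \<times> UNIV) (\<lambda>(e, x). h e x)"
    and cont_g: "continuous_on (S \<times> UNIV) (\<lambda>(e, x). g e x)"
begin

abbreviation flux_of :: "real \<Rightarrow> real \<Rightarrow> real" where "flux_of e \<equiv> flux (g e) (A e)"

lemma compose_param:
  assumes "continuous_on (S \<times> UNIV) (\<lambda>(e, x). k e x)" "continuous_on (S \<times> {a..b}) (\<lambda>(e, t). \<phi> e t)"
  shows "continuous_on (S \<times> {a..b}) (\<lambda>(e, t). (k e (\<phi> e t) :: real))"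
proof -
  have "continuous_on (S \<times> {a..b}) (\<lambda>z. (\<lambda>(e, x). k e x) (fst z, (\<lambda>(e, t). \<phi> e t) z))"
    by (rule continuous_on_compose2[OF assms(1)])
      (auto intro!: continuous_on_Pair continuous_on_fst continuous_on_id assms(2))
  then show ?thesis by (simp add: case_prod_beta)
qed

lemma compose_fixed:
  assumes "continuous_on (S \<times> UNIV) (\<lambda>(e, x). k e x)" "continuous_on {a..b} \<phi>"
  shows "continuous_on (S \<times> {a..b}) (\<lambda>(e, t). (k e (\<phi> t) :: real))"
proof (rule compose_param[OF assms(1)])
  show "continuous_on (S \<times> {a..b}) (\<lambda>(e, t). \<phi> t)"
    using continuous_on_compose2[OF assms(2) continuous_on_snd[OF continuous_on_id], of "S \<times> {a..b}"]
    by (auto simp: case_prod_beta)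
qed

lemma eventually_member: "\<forall>\<^sub>F e in at e0 within S. e \<in> S"
  by (simp add: eventually_at_filter)

text \<open>The solution for \<open>e0\<close> almost solves the equation for a nearby \<open>e\<close>: by compactness \<open>h e\<close> and
  \<open>g e\<close> are uniformly close to \<open>h e0\<close> and \<open>g e0\<close> along it. The a posteriori estimate
  for contractions then bounds the distance of the two solutions.\<close>

lemma A_close:
  assumes e0: "e0 \<in> S" and \<eta>: "\<eta> > 0"
  shows "\<forall>\<^sub>F e in at e0 within S. \<forall>r\<in>{a..b}. \<bar>A e r - A e0 r\<bar> \<le> \<eta>"
proof -
  interpret s0: oscillating_solution m a b "h e0" "g e0" L "A e0" by (rule solution[OF e0])
  define C where "C = 2 * exp (sqrt (2 * L) * (b - a)) * (b - a)"
  have C: "C > 0" using a_less_b by (simp add: C_def)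
  define \<delta> where "\<delta> = \<eta> / (C * (b - a + 1))"
  have \<delta>: "\<delta> > 0" using C \<eta> a_less_b by (simp add: \<delta>_def)
  have "\<forall>\<^sub>F e in at e0 within S. \<forall>t\<in>{a..b}. \<bar>g e (A e0 t) - g e0 (A e0 t)\<bar> \<le> \<delta>"
    by (rule eventually_uniformly_close[OF compose_fixed[OF cont_g s0.cont_A] e0 \<delta>])
  moreover have "\<forall>\<^sub>F e in at e0 within S. \<forall>t\<in>{a..b}. \<bar>h e (flux_of e0 t) - h e0 (flux_of e0 t)\<bar> \<le> \<delta>"
    by (rule eventually_uniformly_close[OF compose_fixed[OF cont_h s0.cont_P] e0 \<delta>])
  ultimately show ?thesis using eventually_member
  proof eventually_elim
    case (elim e)
    interpret s: oscillating_solution m a b "h e" "g e" L "A e" by (rule solution) fact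
    have cont_ge: "continuous_on {a..b} (\<lambda>t. g e (A e0 t))"
      by (rule continuous_on_lipschitz_comp[OF s.g_lip s0.cont_A])
    have int: "\<bar>h e (- avg (\<lambda>t. g e (A e0 t)) s) - h e0 (flux_of e0 s)\<bar> \<le> \<delta> * (b - a + 1)"
      if s: "s \<in> {a..b}" for s
    proof -
      have "\<bar>avg (\<lambda>t. g e (A e0 t)) s - avg (\<lambda>t. g e0 (A e0 t)) s\<bar> \<le> integral {a..s} (\<lambda>_. \<delta>)"
        unfolding avg_diff[OF cont_ge s0.cont_gA s]
        using s elim(1) by (intro abs_avg_le continuous_intros cont_ge s0.cont_gA) auto
      also have "\<dots> \<le> \<delta> * (b - a)" using s \<delta> by (simp add: mult.commute)
      finally have "\<bar>h e (- avg (\<lambda>t. g e (A e0 t)) s) - h e (flux_of e0 s)\<bar> \<le> \<delta> * (b - a)"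
        using lipschitz_onD[OF s.h_lip, of "- avg (\<lambda>t. g e (A e0 t)) s" "flux_of e0 s"]
        by (simp add: flux_def dist_real_def)
      moreover have "\<bar>h e (flux_of e0 s) - h e0 (flux_of e0 s)\<bar> \<le> \<delta>" using elim(2) s by blast
      ultimately show ?thesis by (simp add: distrib_left)
    qed
    have close: "\<bar>picard (h e) (g e) (A e0) r - A e0 r\<bar> \<le> (b - a) * (\<delta> * (b - a + 1))"
      if r: "r \<in> {a..b}" for r
    proof -
      have sub: "continuous_on {a..r} (\<lambda>s. h e (- avg (\<lambda>t. g e (A e0 t)) s))"
          "continuous_on {a..r} (\<lambda>s. h e0 (flux_of e0 s))"
        using continuous_on_picard_integrand[OF s.h_lip s.g_lip s0.cont_A] s0.cont_hP r
        by (auto elim: continuous_on_subset)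
      have "picard (h e) (g e) (A e0) r - picard (h e0) (g e0) (A e0) r
          = integral {a..r} (\<lambda>s. h e (- avg (\<lambda>t. g e (A e0 t)) s) - h e0 (flux_of e0 s))"
        unfolding integral_diff[OF integrable_continuous_real[OF sub(1)] integrable_continuous_real[OF sub(2)]]
        by (simp add: picard_def flux_def)
      also have "norm \<dots> \<le> integral {a..r} (\<lambda>s. \<delta> * (b - a + 1))"
        using r by (intro integral_norm_bound_integral integrable_continuous_real continuous_on_diff
            sub continuous_on_const) (auto intro!: int)
      also have "\<dots> = (r - a) * (\<delta> * (b - a + 1))" using r by simp
      also have "\<dots> \<le> (b - a) * (\<delta> * (b - a + 1))"
        using r \<delta> a_less_b by (intro mult_right_mono) auto
      finally show ?thesis using s0.solves r by (simp add: solves_def)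
    qed
    have "2 * exp (sqrt (2 * L) * (b - a)) * ((b - a) * (\<delta> * (b - a + 1))) = \<eta>"
    proof -
      have "C * (\<delta> * (b - a + 1)) = \<eta>"
        using C a_less_b by (simp add: \<delta>_def)
      then show ?thesis by (simp add: C_def mult.assoc)
    qed
    moreover have "\<bar>A e r - A e0 r\<bar> \<le> 2 * exp (sqrt (2 * L) * (b - a)) * ((b - a) * (\<delta> * (b - a + 1)))"
      if "r \<in> {a..b}" for r
      using s.solves unfolding solves_def
      by (intro picard_near_fixed_point[OF s.h_lip s.g_lip s.L_pos s.cont_A s0.cont_A _ close that]) auto
    ultimately show ?case by simp
  qed
qed

lemma continuous_A: "continuous_on (S \<times> {a..b}) (\<lambda>(e, r). A e r)"
proof (rule jointly_continuous)
  fix e assume "e \<in> S"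
  then interpret s: oscillating_solution m a b "h e" "g e" L "A e" by (rule solution)
  show "continuous_on {a..b} (A e)" by (rule s.cont_A)
qed (rule A_close)

lemma continuous_gA: "continuous_on (S \<times> {a..b}) (\<lambda>(e, r). g e (A e r))"
  by (rule compose_param[OF cont_g continuous_A])

lemma continuous_P: "continuous_on (S \<times> {a..b}) (\<lambda>(e, r). flux_of e r)"
proof (rule jointly_continuous)
  fix e assume "e \<in> S"
  then interpret s: oscillating_solution m a b "h e" "g e" L "A e" by (rule solution)
  show "continuous_on {a..b} (flux_of e)" by (rule s.cont_P)
next
  fix e0 \<eta> :: real assume e0: "e0 \<in> S" and \<eta>: "\<eta> > 0"
  interpret s0: oscillating_solution m a b "h e0" "g e0" L "A e0" by (rule solution[OF e0])
  have "\<forall>\<^sub>F e in at e0 within S. \<forall>r\<in>{a..b}. \<bar>g e (A e r) - g e0 (A e0 r)\<bar> \<le> \<eta> / (b - a)"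
    by (rule eventually_uniformly_close[OF continuous_gA e0]) (use \<eta> a_less_b in simp)
  then show "\<forall>\<^sub>F e in at e0 within S. \<forall>r\<in>{a..b}. \<bar>flux_of e r - flux_of e0 r\<bar> \<le> \<eta>"
    using eventually_member
  proof eventually_elim
    case (elim e)
    interpret s: oscillating_solution m a b "h e" "g e" L "A e" by (rule solution) fact
    show ?case
    proof
      fix r assume r: "r \<in> {a..b}"
      have "\<bar>avg (\<lambda>t. g e (A e t)) r - avg (\<lambda>t. g e0 (A e0 t)) r\<bar> \<le> integral {a..r} (\<lambda>_. \<eta> / (b - a))"
        unfolding avg_diff[OF s.cont_gA s0.cont_gA r]
        using r elim(1) by (intro abs_avg_le continuous_intros s.cont_gA s0.cont_gA) auto
      also have "\<dots> = (r - a) * (\<eta> / (b - a))" using r by simp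
      also have "\<dots> \<le> (b - a) * (\<eta> / (b - a))"
        using r \<eta> a_less_b by (intro mult_right_mono) auto
      also have "\<dots> = \<eta>" using a_less_b by simp
      finally show "\<bar>flux_of e r - flux_of e0 r\<bar> \<le> \<eta>" by (simp add: flux_def abs_minus_commute)
    qed
  qed
qed

definition rotation :: "real \<Rightarrow> real" where
  "rotation e = oscillating_solution.angle m a (h e) (g e) (A e) b"

lemma continuous_rotation: "continuous_on S rotation"
proof -
  have "continuous_on (S \<times> {a..b}) (\<lambda>(e, r).
      (A e r * (r ^ m * g e (A e r)) + r ^ m * flux_of e r * h e (flux_of e r)) / ((A e r)\<^sup>2 + (r ^ m * flux_of e r)\<^sup>2))"
    unfolding case_prod_beta
  proof (intro continuous_intros ballI)
    show "continuous_on (S \<times> {a..b}) (\<lambda>x. A (fst x) (snd x))"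
      and "continuous_on (S \<times> {a..b}) (\<lambda>x. A (fst x) (snd x))"
      and "continuous_on (S \<times> {a..b}) (\<lambda>x. g (fst x) (A (fst x) (snd x)))"
      and "continuous_on (S \<times> {a..b}) (\<lambda>x. flux_of (fst x) (snd x))"
      and "continuous_on (S \<times> {a..b}) (\<lambda>x. flux_of (fst x) (snd x))"
      and "continuous_on (S \<times> {a..b}) (\<lambda>x. h (fst x) (flux_of (fst x) (snd x)))"
      using continuous_A continuous_gA continuous_P compose_param[OF cont_h continuous_P]
      by (simp_all add: case_prod_beta)
    fix x assume x: "x \<in> S \<times> {a..b}"
    then interpret s: oscillating_solution m a b "h (fst x)" "g (fst x)" L "A (fst x)"
      by (intro solution) auto
    show "(A (fst x) (snd x))\<^sup>2 + (snd x ^ m * flux_of (fst x) (snd x))\<^sup>2 \<noteq> 0"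
      using s.nonvanishing[of "snd x"] x by (auto simp: momentum_def)
  qed
  from integral_continuous_on_param[where a = a and b = b, unfolded cbox_interval, OF this]
  show ?thesis
  proof (rule continuous_on_eq)
    fix e assume "e \<in> S"
    then interpret s: oscillating_solution m a b "h e" "g e" L "A e" by (rule solution)
    show "integral {a..b} (\<lambda>r. (A e r * (r ^ m * g e (A e r)) + r ^ m * flux_of e r * h e (flux_of e r))
        / ((A e r)\<^sup>2 + (r ^ m * flux_of e r)\<^sup>2)) = rotation e"
      unfolding rotation_def s.angle_def s.spin_def[abs_def] momentum_def by (rule refl)
  qed
qed

end

section \<open>The linear equation and its eigenvalues\<close>

lemma abs_cos_squared_diff_le: "\<bar>(cos x)\<^sup>2 - (cos y)\<^sup>2\<bar> \<le> \<bar>x - y\<bar>" for x y :: real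
proof -
  have "(cos x)\<^sup>2 - (cos y)\<^sup>2 = - (sin (x + y) * sin (x - y))"
  proof -
    have "(sin x)\<^sup>2 = 1 - (cos x)\<^sup>2" "(sin y)\<^sup>2 = 1 - (cos y)\<^sup>2" by (simp_all add: sin_squared_eq)
    then show ?thesis unfolding sin_add sin_diff by algebra
  qed
  then have "\<bar>(cos x)\<^sup>2 - (cos y)\<^sup>2\<bar> = \<bar>sin (x + y)\<bar> * \<bar>sin (x - y)\<bar>" by (simp add: abs_mult)
  also have "\<dots> \<le> 1 * \<bar>sin (x - y)\<bar>" by (intro mult_right_mono) auto
  also have "\<bar>sin (x - y)\<bar> \<le> \<bar>x - y\<bar>"
  proof -
    have "sin (x - y) = - sin (y - x)" by (metis minus_diff_eq sin_minus)
    then show ?thesis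
      using sin_x_le_x[of "\<bar>x - y\<bar>"] sin_x_ge_neg_x[of "\<bar>x - y\<bar>"]
      by (cases "x \<ge> y") (auto simp: abs_if)
  qed
  finally show ?thesis by simp
qed

text \<open>As long as \<open>D\<close> is positive, \<open>D r * exp (C * r)\<close> does not decrease; so \<open>D\<close> has no first zero.\<close>

lemma positivity_persists:
  fixes D D' :: "real \<Rightarrow> real"
  assumes "c \<le> d" and cont: "continuous_on {c..d} D" and Dc: "D c > 0"
    and deriv: "\<And>r. r \<in> {c<..<d} \<Longrightarrow> (D has_real_derivative D' r) (at r)"
    and bound: "\<And>r. r \<in> {c<..<d} \<Longrightarrow> D' r \<ge> - C * \<bar>D r\<bar>"
  shows "D d > 0"
proof (rule ccontr)
  assume neg: "\<not> D d > 0"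
  define Z where "Z = {r \<in> {c..d}. D r = 0}"
  have "Z = {c..d} \<inter> D -` {0}" by (auto simp: Z_def)
  then have "closed Z" using continuous_closed_preimage[OF cont closed_atLeastAtMost, of "{0}"] by simp
  then have "compact Z"
    by (auto simp: compact_eq_bounded_closed Z_def intro: bounded_subset[OF bounded_closed_interval])
  have zero: "\<exists>s\<ge>c. s \<le> r \<and> D s = 0" if "r \<in> {c..d}" "D r \<le> 0" for r
    using that Dc by (intro IVT2' continuous_on_subset[OF cont]) auto
  have "Z \<noteq> {}"
  proof -
    obtain s where "s \<ge> c" "s \<le> d" "D s = 0" using zero[of d] neg \<open>c \<le> d\<close> by auto
    then have "s \<in> Z" by (simp add: Z_def)
    then show ?thesis by blast
  qed
  with \<open>compact Z\<close> obtain r0 where r0: "r0 \<in> Z" and least: "\<And>r. r \<in> Z \<Longrightarrow> r0 \<le> r"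
    using compact_attains_inf by metis
  have r0_cd: "r0 \<in> {c..d}" "D r0 = 0" using r0 by (auto simp: Z_def)
  have pos: "D r > 0" if r: "c \<le> r" "r < r0" for r
  proof (rule ccontr)
    assume "\<not> D r > 0"
    then obtain s where "s \<ge> c" "s \<le> r" "D s = 0" using zero[of r] r r0_cd by auto
    then have "s \<in> Z" using r r0_cd by (auto simp: Z_def)
    with least[of s] \<open>s \<le> r\<close> r show False by simp
  qed
  have "D c * exp (C * c) \<le> D r0 * exp (C * r0)"
  proof (rule DERIV_nonneg_imp_increasing_open[where f = "\<lambda>r. D r * exp (C * r)"])
    show "continuous_on {c..r0} (\<lambda>r. D r * exp (C * r))"
      using r0_cd by (intro continuous_intros continuous_on_subset[OF cont]) auto
    fix r assume r: "c < r" "r < r0"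
    then have rcd: "r \<in> {c<..<d}" using r0_cd by auto
    have "((\<lambda>r. D r * exp (C * r)) has_real_derivative (D' r + C * D r) * exp (C * r)) (at r)"
      by (rule derivative_eq_intros refl deriv[OF rcd])+ (simp add: algebra_simps)
    moreover have "D' r + C * D r \<ge> 0" using bound[OF rcd] pos[of r] r by simp
    ultimately show "\<exists>y. ((\<lambda>r. D r * exp (C * r)) has_real_derivative y) (at r) \<and> 0 \<le> y"
      by (metis mult_nonneg_nonneg exp_ge_zero)
  qed (use r0_cd in auto)
  with r0_cd Dc show False by (simp add: not_le[symmetric] mult_le_0_iff)
qed

context radial_interval begin

text \<open>Eigenfunctions are given by derivatives in the open interval. The fundamental theorem of calculus
  turns them into fixed points, to which uniqueness applies.\<close>

lemma solves_if_derivatives: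
  assumes A: "continuous_on {a..b} A" "A a = 1" and Q: "continuous_on {a..b} Q" "Q a = 0"
    and h: "1-lipschitz_on UNIV h" and g: "L-lipschitz_on UNIV g"
    and dA: "\<And>r. r \<in> {a<..<b} \<Longrightarrow> (A has_real_derivative h (Q r)) (at r)"
    and dQ: "\<And>r. r \<in> {a<..<b} \<Longrightarrow> ((\<lambda>s. s ^ m * Q s) has_real_derivative - (r ^ m * g (A r))) (at r)"
  shows "solves h g A" and "r \<in> {a..b} \<Longrightarrow> flux g A r = Q r"
proof -
  show flux: "flux g A r = Q r" if r: "r \<in> {a..b}" for r
  proof (cases "r = a")
    case True
    then show ?thesis using Q by simp
  next
    case False
    then have r_pos: "r > 0" using r a_nonneg by auto
    have "((\<lambda>r. - (r ^ m * g (A r))) has_integral (r ^ m * Q r - a ^ m * Q a)) {a..r}"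
    proof (rule fundamental_theorem_of_calculus_interior[where f = "\<lambda>s. s ^ m * Q s"])
      show "continuous_on {a..r} (\<lambda>s. s ^ m * Q s)"
        using r by (intro continuous_intros continuous_on_subset[OF Q(1)]) auto
    qed (use r dQ in \<open>auto simp flip: has_real_derivative_iff_has_vector_derivative\<close>)
    then have "((\<lambda>r. r ^ m * g (A r)) has_integral (- (r ^ m * Q r))) {a..r}"
      using has_integral_neg[of "\<lambda>r. - (r ^ m * g (A r))"] Q by simp
    then have "integral {a..r} (\<lambda>r. r ^ m * g (A r)) = - (r ^ m * Q r)" by (rule integral_unique)
    then show ?thesis using r_pos by (simp add: flux_def avg_def)
  qed
  have "A r = picard h g A r" if r: "r \<in> {a..b}" for r
  proof -
    have "((\<lambda>r. h (Q r)) has_integral (A r - A a)) {a..r}"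
    proof (rule fundamental_theorem_of_calculus_interior[where f = A])
      show "continuous_on {a..r} A" using r by (intro continuous_on_subset[OF A(1)]) auto
    qed (use r dA in \<open>auto simp flip: has_real_derivative_iff_has_vector_derivative\<close>)
    then have "integral {a..r} (\<lambda>r. h (Q r)) = A r - 1" using A by (simp add: integral_unique)
    moreover have "integral {a..r} (\<lambda>r. h (Q r)) = integral {a..r} (\<lambda>r. h (flux g A r))"
      using flux r by (intro integral_cong) auto
    ultimately show ?thesis by (simp add: picard_def flux_def)
  qed
  with A show "solves h g A" by (simp add: solves_def)
qed

lemma flux_cong:
  assumes "\<And>t. t \<in> {a..r} \<Longrightarrow> A t = A' t"
  shows "flux g A r = flux g A' r"
  unfolding flux_def avg_def using assms by (auto intro!: arg_cong[where f = "\<lambda>x. x / _"] integral_cong)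

definition linear_sol :: "real \<Rightarrow> real \<Rightarrow> real" where
  "linear_sol lam = (SOME A. solves (\<lambda>x. x) (\<lambda>x. lam * x) A)"

lemma lipschitz_mult: "(\<bar>lam\<bar> + 1)-lipschitz_on UNIV (\<lambda>x::real. lam * x)"
  by (rule lipschitz_onI) (auto simp: dist_real_def abs_mult mult_right_mono simp flip: right_diff_distrib)

lemma lipschitz_ident: "1-lipschitz_on UNIV (\<lambda>x::real. x)"
  by (rule lipschitz_onI) auto

lemma linear_oscillating:
  "oscillating_solution m a b (\<lambda>x. x) (\<lambda>x. lam * x) (\<bar>lam\<bar> + 1) (linear_sol lam)"
proof unfold_locales
  show "solves (\<lambda>x. x) (\<lambda>x. lam * x) (linear_sol lam)"
    unfolding linear_sol_def
    by (rule someI_ex[OF solves_exists[OF lipschitz_ident lipschitz_mult]]) simp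
qed (use lipschitz_ident lipschitz_mult in auto)

definition linear_rotation :: "real \<Rightarrow> real" where
  "linear_rotation lam = oscillating_solution.angle m a (\<lambda>x. x) (\<lambda>x. lam * x) (linear_sol lam) b"

text \<open>Sturm comparison of the angles for \<open>lam < mu\<close>. The equation for the angles is singular at the
  left end of a ball, so the first gain is obtained from the Wronskian: near the left end both
  solutions are positive, the Wronskian increases from \<open>0\<close>, and it has the sign of the sine of the
  difference \<open>D\<close> of the angles. From the point \<open>c\<close> on, the difference satisfies \<open>D' \<ge> - C * \<bar>D\<bar>\<close>
  and stays positive.\<close>

lemma linear_rotation_strict_mono:
  assumes "lam < mu"
  shows "linear_rotation lam < linear_rotation mu"
proof -
  interpret l: oscillating_solution m a b "\<lambda>x. x" "\<lambda>x. lam * x" "\<bar>lam\<bar> + 1" "linear_sol lam"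
    by (rule linear_oscillating)
  interpret u: oscillating_solution m a b "\<lambda>x. x" "\<lambda>x. mu * x" "\<bar>mu\<bar> + 1" "linear_sol mu"
    by (rule linear_oscillating)
  define D where "D r = u.angle r - l.angle r" for r
  have cD: "continuous_on {a..b} D" unfolding D_def by (intro continuous_intros u.cont_angle l.cont_angle)
  have near: "\<forall>\<^sub>F r in at_right a. k r > 0" if "continuous_on {a..b} k" "k a > 0" for k :: "real \<Rightarrow> real"
  proof -
    have "(k \<longlongrightarrow> k a) (at_right a)"
      using that a_less_b unfolding continuous_on_def at_within_Icc_at_right[OF a_less_b, symmetric]
      by (metis atLeastAtMost_iff less_imp_le order_refl)
    then show ?thesis using that(2) by (rule order_tendstoD)
  qed
  have "\<forall>\<^sub>F r in at_right a. r < b"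
    using a_less_b by (auto simp: eventually_at_right_field)
  moreover have "\<forall>\<^sub>F r in at_right a. pi - \<bar>D r\<bar> > 0"
  proof (rule near)
    show "continuous_on {a..b} (\<lambda>r. pi - \<bar>D r\<bar>)" by (intro continuous_intros cD)
  qed (simp add: D_def)
  moreover have "\<forall>\<^sub>F r in at_right a. linear_sol lam r > 0" by (rule near[OF l.cont_A]) simp
  moreover have "\<forall>\<^sub>F r in at_right a. linear_sol mu r > 0" by (rule near[OF u.cont_A]) simp
  ultimately have "\<forall>\<^sub>F r in at_right a. linear_sol lam r > 0 \<and> linear_sol mu r > 0 \<and> \<bar>D r\<bar> < pi \<and> r < b"
    by eventually_elim simp
  then obtain r1 where r1: "r1 > a"
    and close: "\<And>r. a < r \<Longrightarrow> r < r1 \<Longrightarrow> linear_sol lam r > 0 \<and> linear_sol mu r > 0 \<and> \<bar>D r\<bar> < pi \<and> r < b"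
    unfolding eventually_at_right_field by auto
  define c where "c = (a + r1) / 2"
  have c: "a < c" "c < r1" using r1 by (simp_all add: c_def)
  have c_pos: "c > 0" using c a_nonneg by simp
  have cb: "c < b" using close c by simp
  define W where "W r = l.B r * linear_sol mu r - linear_sol lam r * u.B r" for r
  have "W a < W c"
  proof (rule DERIV_pos_imp_increasing_open[where f = W, OF c(1)])
    show "continuous_on {a..c} W"
      unfolding W_def using cb
      by (intro continuous_intros continuous_on_subset[OF l.cont_A] continuous_on_subset[OF l.cont_B]
          continuous_on_subset[OF u.cont_A] continuous_on_subset[OF u.cont_B]) auto
    fix r assume r: "a < r" "r < c"
    then have rab: "r \<in> {a<..<b}" using cb by auto
    have "(W has_real_derivative (mu - lam) * r ^ m * linear_sol lam r * linear_sol mu r) (at r)"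
      unfolding W_def
      by (rule derivative_eq_intros refl l.A_deriv[OF rab] l.B_deriv[OF rab] u.A_deriv[OF rab] u.B_deriv[OF rab])+
        (unfold momentum_def, algebra)
    moreover have "(mu - lam) * r ^ m * linear_sol lam r * linear_sol mu r > 0"
      using close[of r] r c assms a_nonneg by (intro mult_pos_pos) auto
    ultimately show "\<exists>y. (W has_real_derivative y) (at r) \<and> y > 0" by blast
  qed
  then have W_pos: "W c > 0" by (simp add: W_def)
  have D_pos: "D c > 0"
  proof -
    have c': "c \<in> {a..b}" using c cb by simp
    obtain \<rho> where \<rho>: "\<rho> > 0" "linear_sol lam c = \<rho> * cos (l.angle c)" "l.B c = - \<rho> * sin (l.angle c)"
      by (rule l.polar[OF c'])
    obtain \<sigma> where \<sigma>: "\<sigma> > 0" "linear_sol mu c = \<sigma> * cos (u.angle c)" "u.B c = - \<sigma> * sin (u.angle c)"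
      by (rule u.polar[OF c'])
    have "W c = (\<rho> * \<sigma>) * sin (D c)"
      unfolding W_def \<rho>(2,3) \<sigma>(2,3) D_def sin_diff by (simp add: algebra_simps)
    then have "(\<rho> * \<sigma>) * sin (D c) > 0" using W_pos by metis
    then have "sin (D c) > 0" by (rule zero_less_mult_pos) (rule mult_pos_pos[OF \<rho>(1) \<sigma>(1)])
    moreover have "\<bar>D c\<bar> < pi" using close c by simp
    ultimately show ?thesis using sin_ge_zero[of "- D c"] by (cases "D c \<le> 0") auto
  qed
  have "D b > 0"
  proof (rule positivity_persists[where D = D and c = c and d = b and D' = "\<lambda>r. u.spin r - l.spin r"
        and C = "\<bar>lam\<bar> * b ^ m + 1 / c ^ m"])
    show "continuous_on {c..b} D" using c by (intro continuous_on_subset[OF cD]) auto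
    fix r assume r: "r \<in> {c<..<b}"
    then have rab: "r \<in> {a<..<b}" and r_pos: "r > 0" using c c_pos by auto
    then have r': "r \<in> {a..b}" by simp
    show "(D has_real_derivative u.spin r - l.spin r) (at r)"
      unfolding D_def by (intro DERIV_diff u.angle_deriv l.angle_deriv rab)
    have spin: "oscillating_solution.spin m a (\<lambda>x. x) (\<lambda>x. k * x) (linear_sol k) r
        = k * r ^ m * (cos \<theta>)\<^sup>2 + (1 - (cos \<theta>)\<^sup>2) / r ^ m"
      if \<theta>: "\<theta> = oscillating_solution.angle m a (\<lambda>x. x) (\<lambda>x. k * x) (linear_sol k) r" for k \<theta>
    proof -
      interpret s: oscillating_solution m a b "\<lambda>x. x" "\<lambda>x. k * x" "\<bar>k\<bar> + 1" "linear_sol k"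
        by (rule linear_oscillating)
      obtain \<rho> where \<rho>: "\<rho> > 0" "linear_sol k r = \<rho> * cos \<theta>" "s.B r = - \<rho> * sin \<theta>"
        by (rule s.polar[OF r', folded \<theta>])
      have P: "s.P r = s.B r / r ^ m" using r_pos by (simp add: momentum_def)
      have "(\<rho> * cos \<theta>)\<^sup>2 + (- \<rho> * sin \<theta>)\<^sup>2 = \<rho>\<^sup>2 * ((cos \<theta>)\<^sup>2 + (sin \<theta>)\<^sup>2)" by algebra
      then have "s.spin r = (\<rho> * cos \<theta> * (r ^ m * (k * (\<rho> * cos \<theta>))) + - \<rho> * sin \<theta> * (- \<rho> * sin \<theta> / r ^ m)) / \<rho>\<^sup>2"
        unfolding s.spin_def P \<rho>(2,3) by simp
      also have "\<dots> = k * r ^ m * (cos \<theta>)\<^sup>2 + (sin \<theta>)\<^sup>2 / r ^ m"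
        using \<rho>(1) r_pos by (simp add: field_simps power2_eq_square)
      finally show ?thesis by (simp add: sin_squared_eq)
    qed
    define x y where "x = (cos (u.angle r))\<^sup>2" and "y = (cos (l.angle r))\<^sup>2"
    have xy: "\<bar>x - y\<bar> \<le> \<bar>D r\<bar>" unfolding x_def y_def D_def by (rule abs_cos_squared_diff_le)
    have "u.spin r - l.spin r = mu * r ^ m * x - lam * r ^ m * y - (x - y) / r ^ m"
      unfolding spin[OF refl] x_def y_def by (simp add: diff_divide_distrib)
    moreover have "lam * r ^ m * x \<le> mu * r ^ m * x"
      using assms r_pos by (intro mult_right_mono) (auto simp: x_def)
    ultimately have "u.spin r - l.spin r \<ge> (lam * r ^ m - 1 / r ^ m) * (x - y)"
      by (simp add: algebra_simps)
    moreover have "\<bar>(lam * r ^ m - 1 / r ^ m) * (x - y)\<bar> \<le> (\<bar>lam\<bar> * b ^ m + 1 / c ^ m) * \<bar>D r\<bar>"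
      unfolding abs_mult
    proof (intro mult_mono xy)
      have "\<bar>lam * r ^ m\<bar> \<le> \<bar>lam\<bar> * b ^ m"
        unfolding abs_mult using r_pos r by (intro mult_left_mono) (auto simp: power_abs intro!: power_mono)
      moreover have "1 / r ^ m \<le> 1 / c ^ m"
        using r c_pos by (intro divide_left_mono power_mono) auto
      moreover have "1 / r ^ m > 0" using r_pos by simp
      ultimately show "\<bar>lam * r ^ m - 1 / r ^ m\<bar> \<le> \<bar>lam\<bar> * b ^ m + 1 / c ^ m" by linarith
    qed (use c_pos cb in auto)
    ultimately show "u.spin r - l.spin r \<ge> - (\<bar>lam\<bar> * b ^ m + 1 / c ^ m) * \<bar>D r\<bar>"
      unfolding mult_minus_left abs_le_iff by linarith
  qed (use D_pos cb in auto)
  then show ?thesis by (simp add: D_def linear_rotation_def)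
qed

lemma linear_rotation_nonneg:
  assumes "lam \<ge> 0"
  shows "linear_rotation lam \<ge> 0"
proof -
  interpret s: oscillating_solution m a b "\<lambda>x. x" "\<lambda>x. lam * x" "\<bar>lam\<bar> + 1" "linear_sol lam"
    by (rule linear_oscillating)
  show ?thesis
    unfolding linear_rotation_def s.angle_def
  proof (rule integral_nonneg)
    show "s.spin integrable_on {a..b}" by (rule integrable_continuous_real[OF s.cont_spin])
    fix r assume r: "r \<in> {a..b}"
    have "linear_sol lam r * (r ^ m * (lam * linear_sol lam r)) + s.B r * s.P r
        = r ^ m * lam * (linear_sol lam r)\<^sup>2 + r ^ m * (s.P r)\<^sup>2"
      unfolding momentum_def by algebra
    also have "\<dots> \<ge> 0"
      using r a_nonneg assms by (intro add_nonneg_nonneg mult_nonneg_nonneg) auto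
    finally show "s.spin r \<ge> 0"
      unfolding s.spin_def by (intro divide_nonneg_nonneg) auto
  qed
qed

text \<open>An eigenfunction \<open>u\<close> is a multiple of \<open>linear_sol lam\<close>: with \<open>c = u a\<close>, the function
  \<open>u + (1 - c) * linear_sol lam\<close> solves the same initial value problem as \<open>linear_sol lam\<close>.
  This form also covers \<open>c = 0\<close>, where it shows that \<open>u\<close> vanishes.\<close>

lemma eigenvalue_imp_momentum_zero:
  assumes "radial_neumann_eigenvalue (Suc m) a b lam"
  shows "momentum (\<lambda>x. lam * x) (linear_sol lam) b = 0"
proof -
  interpret s: oscillating_solution m a b "\<lambda>x. x" "\<lambda>x. lam * x" "\<bar>lam\<bar> + 1" "linear_sol lam"
    by (rule linear_oscillating)
  obtain u u' where cont: "continuous_on {a..b} u'"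
    and du_ball: "\<forall>r\<in>{a..b}. (u has_real_derivative u' r) (at r within {a..b})"
    and du'_ball: "\<forall>r\<in>{a<..<b}. ((\<lambda>s. s ^ m * u' s) has_real_derivative - (lam * r ^ m * u r)) (at r)"
    and ends: "u' a = 0" "u' b = 0" and nontrivial: "\<exists>r\<in>{a..b}. u r \<noteq> 0"
    using assms unfolding radial_neumann_eigenvalue_def diff_Suc_1 by blast
  note du = du_ball[rule_format] and du' = du'_ball[rule_format]
  define c where "c = u a"
  define A where "A r = u r + (1 - c) * linear_sol lam r" for r
  define Q where "Q r = u' r + (1 - c) * s.P r" for r
  have cu: "continuous_on {a..b} u" using du by (meson DERIV_continuous_on)
  have 1: "continuous_on {a..b} A" "A a = 1" "continuous_on {a..b} Q" "Q a = 0"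
    unfolding A_def Q_def
    by (intro continuous_intros cu cont s.cont_A s.cont_P, simp add: c_def,
        intro continuous_intros cu cont s.cont_A s.cont_P, simp add: ends)
  have dA: "(A has_real_derivative Q r) (at r)" if "r \<in> {a<..<b}" for r
  proof -
    have "(u has_real_derivative u' r) (at r)" using du[of r] that by (simp add: at_within_Icc_at)
    then show ?thesis unfolding A_def Q_def by (intro DERIV_add DERIV_cmult s.A_deriv that)
  qed
  have dQ: "((\<lambda>s. s ^ m * Q s) has_real_derivative - (r ^ m * (lam * A r))) (at r)" if "r \<in> {a<..<b}" for r
  proof -
    have "((\<lambda>r. r ^ m * u' r + (1 - c) * s.B r) has_real_derivative
        (- (lam * r ^ m * u r) + (1 - c) * - (r ^ m * (lam * linear_sol lam r)))) (at r)"
      by (intro DERIV_add DERIV_cmult s.B_deriv that du')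
    then show ?thesis by (simp add: A_def Q_def momentum_def algebra_simps)
  qed
  note sol = solves_if_derivatives[OF 1 lipschitz_ident lipschitz_mult dA dQ]
  have eq: "A r = linear_sol lam r" if "r \<in> {a..b}" for r
    by (rule solves_unique[OF lipschitz_ident lipschitz_mult _ sol(1) s.solves that]) simp
  have "Q b = s.P b"
    using sol(2)[of b] flux_cong[of b A "linear_sol lam"] eq a_less_b by auto
  then have "c * s.P b = 0" by (simp add: Q_def ends algebra_simps)
  moreover have "c \<noteq> 0" using nontrivial eq by (auto simp: A_def)
  ultimately show ?thesis by (simp add: momentum_def)
qed

text \<open>For \<open>lam < 0\<close> the product of solution and momentum strictly increases from \<open>0\<close>, so the momentum
  cannot vanish at the right end.\<close>

lemma eigenvalue_nonneg:
  assumes "radial_neumann_eigenvalue (Suc m) a b lam"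
  shows "lam \<ge> 0"
proof (rule ccontr)
  assume "\<not> lam \<ge> 0"
  then have neg: "lam < 0" by simp
  interpret s: oscillating_solution m a b "\<lambda>x. x" "\<lambda>x. lam * x" "\<bar>lam\<bar> + 1" "linear_sol lam"
    by (rule linear_oscillating)
  define E where "E r = linear_sol lam r * s.B r" for r
  have cE: "continuous_on {a..b} E" unfolding E_def by (intro continuous_intros s.cont_A s.cont_B)
  have dE: "(E has_real_derivative r ^ m * ((s.P r)\<^sup>2 - lam * (linear_sol lam r)\<^sup>2)) (at r)"
    if "r \<in> {a<..<b}" for r
    unfolding E_def
    by (rule derivative_eq_intros refl s.A_deriv[OF that] s.B_deriv[OF that])+
      (unfold momentum_def, algebra)
  have pos: "(s.P r)\<^sup>2 - lam * (linear_sol lam r)\<^sup>2 \<ge> 0" for r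
    using mult_nonpos_nonneg[OF less_imp_le[OF neg] zero_le_power2[of "linear_sol lam r"]]
      zero_le_power2[of "s.P r"] by linarith
  have "E a < E b"
  proof (rule DERIV_pos_imp_increasing_open[where f = E, OF a_less_b _ cE])
    fix r assume r: "a < r" "r < b"
    have "(s.P r)\<^sup>2 - lam * (linear_sol lam r)\<^sup>2 \<noteq> 0"
    proof
      assume "(s.P r)\<^sup>2 - lam * (linear_sol lam r)\<^sup>2 = 0"
      moreover have "- lam * (linear_sol lam r)\<^sup>2 \<ge> 0" using neg by (intro mult_nonneg_nonneg) auto
      ultimately have "(s.P r)\<^sup>2 = 0" "lam * (linear_sol lam r)\<^sup>2 = 0"
        using zero_le_power2[of "s.P r"] by linarith+
      then have "s.P r = 0" "linear_sol lam r = 0" using neg by auto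
      then show False using s.nonvanishing[of r] r by (simp add: momentum_def)
    qed
    then have "r ^ m * ((s.P r)\<^sup>2 - lam * (linear_sol lam r)\<^sup>2) > 0"
      using pos[of r] r a_nonneg by (intro mult_pos_pos) auto
    then show "\<exists>y. (E has_real_derivative y) (at r) \<and> 0 < y" using dE[of r] r by auto
  qed
  then show False using eigenvalue_imp_momentum_zero[OF assms] by (simp add: E_def)
qed

lemma eigenvalue_rotation:
  assumes "radial_neumann_eigenvalue (Suc m) a b lam"
  shows "\<exists>j::nat. linear_rotation lam = real j * pi"
proof -
  interpret s: oscillating_solution m a b "\<lambda>x. x" "\<lambda>x. lam * x" "\<bar>lam\<bar> + 1" "linear_sol lam"
    by (rule linear_oscillating)
  obtain \<rho> where "\<rho> > 0" "s.B b = - \<rho> * sin (s.angle b)"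
    using s.polar[of b] a_less_b by auto
  then have "sin (linear_rotation lam) = 0"
    using eigenvalue_imp_momentum_zero[OF assms] by (simp add: linear_rotation_def)
  then obtain i :: int where i: "linear_rotation lam = of_int i * pi"
    unfolding sin_zero_iff_int2 by auto
  have "i \<ge> 0"
    using linear_rotation_nonneg[OF eigenvalue_nonneg[OF assms]] pi_gt_zero by (auto simp: i zero_le_mult_iff)
  then show ?thesis using i by (intro exI[of _ "nat i"]) simp
qed

text \<open>The \<open>k + 1\<close> eigenvalues up to \<open>lam\<close> have rotations that are distinct nonnegative multiples of
  \<open>pi\<close>, and the largest belongs to \<open>lam\<close>.\<close>

lemma kth_eigenvalue_rotation:
  assumes "is_kth_radial_neumann_eigenvalue (Suc m) a b (k + 1) lam"
  shows "real k * pi \<le> linear_rotation lam"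
proof -
  define S where "S = {\<mu>. radial_neumann_eigenvalue (Suc m) a b \<mu> \<and> \<mu> \<le> lam}"
  have card: "card S = k + 1" and lam: "lam \<in> S"
    using assms by (auto simp: S_def is_kth_radial_neumann_eigenvalue_def)
  have "\<forall>\<mu>\<in>S. \<exists>j::nat. linear_rotation \<mu> = real j * pi"
    using eigenvalue_rotation by (simp add: S_def)
  then obtain j :: "real \<Rightarrow> nat" where j: "\<And>\<mu>. \<mu> \<in> S \<Longrightarrow> linear_rotation \<mu> = real (j \<mu>) * pi" by metis
  have mono: "j \<mu> < j \<nu>" if "\<mu> \<in> S" "\<nu> \<in> S" "\<mu> < \<nu>" for \<mu> \<nu>
    using linear_rotation_strict_mono[OF that(3)] j that by simp
  have "inj_on j S"
    by (rule linorder_inj_onI) (use mono in \<open>force+\<close>)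
  moreover have "j ` S \<subseteq> {..j lam}"
  proof safe
    fix \<mu> assume "\<mu> \<in> S"
    then show "j \<mu> \<le> j lam" using mono[of \<mu> lam] lam by (cases "\<mu> = lam") (auto simp: S_def)
  qed
  ultimately have "card S \<le> card {..j lam}"
    by (intro card_inj_on_le) auto
  then have "k \<le> j lam" using card by simp
  then show ?thesis using j[OF lam] by simp
qed

end

section \<open>Counting zeros by the angle\<close>

text \<open>The sign conditions make the point \<open>(A, B)\<close> turn clockwise only.\<close>

locale monotone_oscillation = oscillating_solution +
  assumes g_sign: "x * g x \<ge> 0" and h_sign: "x \<noteq> 0 \<Longrightarrow> x * h x > 0"
begin

lemma spin_nonneg:
  assumes "r \<in> {a..b}"
  shows "spin r \<ge> 0"
proof -
  have "A r * (r ^ m * g (A r)) + B r * h (P r) = r ^ m * (A r * g (A r)) + r ^ m * (P r * h (P r))"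
    unfolding momentum_def by algebra
  also have "\<dots> \<ge> 0"
  proof -
    have "r ^ m \<ge> 0" using assms a_nonneg by simp
    moreover have "P r * h (P r) \<ge> 0" using h_sign[of "P r"] by (cases "P r = 0") auto
    ultimately show ?thesis using g_sign by (intro add_nonneg_nonneg mult_nonneg_nonneg[of "r ^ m"])
  qed
  finally show ?thesis unfolding spin_def by (intro divide_nonneg_nonneg) auto
qed

lemma angle_mono:
  assumes "a \<le> r" "r \<le> s" "s \<le> b"
  shows "angle r \<le> angle s"
proof (rule DERIV_nonneg_imp_increasing_open[where f = angle])
  show "continuous_on {r..s} angle" using assms by (intro continuous_on_subset[OF cont_angle]) auto
  fix x assume "r < x" "x < s"
  then show "\<exists>y. (angle has_real_derivative y) (at x) \<and> 0 \<le> y"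
    using assms angle_deriv[of x] spin_nonneg[of x] by auto
qed fact

lemma A_zero_iff:
  assumes "r \<in> {a..b}"
  shows "A r = 0 \<longleftrightarrow> cos (angle r) = 0"
proof -
  obtain \<rho> where "\<rho> > 0" "A r = \<rho> * cos (angle r)" by (rule polar[OF assms])
  then show ?thesis by auto
qed

lemma spin_pos_at_zero:
  assumes r: "r \<in> {a<..<b}" and A: "A r = 0"
  shows "spin r > 0"
proof -
  have r_pos: "r > 0" using r a_nonneg by simp
  have "B r \<noteq> 0" using nonvanishing[of r] r A by auto
  then have "P r \<noteq> 0" by (auto simp: momentum_def)
  then have "r ^ m * (P r * h (P r)) > 0" using h_sign r_pos by simp
  then have "B r * h (P r) > 0" by (simp add: momentum_def mult.assoc)
  then show ?thesis using nonvanishing[of r] r A by (simp add: spin_def)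
qed

text \<open>The angle strictly increases where \<open>A\<close> vanishes, so it takes different values at different
  zeros.\<close>

lemma angle_inj_on_zeros: "inj_on angle {r \<in> {a<..<b}. A r = 0}"
proof (rule linorder_inj_onI)
  fix r s assume rs: "r < s" and r: "r \<in> {r \<in> {a<..<b}. A r = 0}" and s: "s \<in> {r \<in> {a<..<b}. A r = 0}"
  obtain d where d: "d > 0" "\<And>t. 0 < t \<Longrightarrow> t < d \<Longrightarrow> angle r < angle (r + t)"
    using DERIV_pos_inc_right[OF angle_deriv spin_pos_at_zero] r by auto
  define t where "t = min (d / 2) (s - r)"
  have t: "0 < t" "t < d" "r + t \<le> s" using d rs by (auto simp: t_def)
  have "angle r < angle (r + t)" by (rule d(2)[OF t(1,2)])
  also have "\<dots> \<le> angle s" using t r s by (intro angle_mono) auto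
  finally show "angle r \<noteq> angle s" by simp
qed auto

text \<open>The zeros of \<open>A\<close> are the points where the angle is an odd multiple of \<open>pi / 2\<close>. The angle grows
  from \<open>0\<close> to \<open>j * pi\<close>, and meets each of the \<open>j\<close> odd multiples in between exactly once.\<close>

lemma card_zeros:
  assumes rot: "angle b = real j * pi"
  shows "card {r \<in> {a<..<b}. A r = 0} = j"
proof -
  have "angle ` {r \<in> {a<..<b}. A r = 0} = (\<lambda>i. real i * pi + pi / 2) ` {..<j}"
  proof (intro equalityI subsetI)
    fix y assume "y \<in> angle ` {r \<in> {a<..<b}. A r = 0}"
    then obtain r where r: "r \<in> {a<..<b}" "A r = 0" and y: "y = angle r" by auto
    then have "cos y = 0" using A_zero_iff[of r] by simp
    then obtain n :: int where n: "y = of_int n * pi + pi / 2" unfolding cos_zero_iff_int2 by auto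
    have "0 \<le> y" "y \<le> real j * pi"
      using angle_mono[of a r] angle_mono[of r b] r y rot a_less_b by auto
    then have "(- 1/2) * pi \<le> of_int n * pi" "of_int n * pi \<le> (real j - 1/2) * pi"
      unfolding n by (simp_all add: algebra_simps)
    then have "- 1/2 \<le> real_of_int n" "real_of_int n \<le> real j - 1/2"
      by (simp_all only: mult_le_cancel_right_pos[OF pi_gt_zero])
    then have "n > -1" "n < int j" by linarith+
    then have "nat n < j" "y = real (nat n) * pi + pi / 2" using n by auto
    then show "y \<in> (\<lambda>i. real i * pi + pi / 2) ` {..<j}" by auto
  next
    fix y assume "y \<in> (\<lambda>i. real i * pi + pi / 2) ` {..<j}"
    then obtain i where i: "i < j" and y: "y = real i * pi + pi / 2" by auto
    have "(real i + 1/2) * pi < real j * pi"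
      using i by (intro mult_strict_right_mono) auto
    then have y_less: "y < real j * pi" by (simp add: y algebra_simps)
    have y_pos: "y > 0" by (simp add: y add_nonneg_pos)
    have "\<exists>r\<ge>a. r \<le> b \<and> angle r = y"
      using y_less y_pos rot a_less_b cont_angle by (intro IVT') auto
    then obtain r where r: "a \<le> r" "r \<le> b" "angle r = y" by auto
    then have "r \<noteq> a" "r \<noteq> b" using y_pos y_less rot by auto
    moreover have "cos y = 0" unfolding cos_zero_iff_int2 y by (intro exI[of _ "int i"]) simp
    then have "A r = 0" using A_zero_iff[of r] r by simp
    ultimately show "y \<in> angle ` {r \<in> {a<..<b}. A r = 0}" using r by force
  qed
  moreover have "inj_on (\<lambda>i. real i * pi + pi / 2) {..<j}" by (intro inj_onI) auto
  ultimately show ?thesis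
    using card_image[OF angle_inj_on_zeros] card_image[of "\<lambda>i. real i * pi + pi / 2" "{..<j}"] by simp
qed

lemma flux_zero_at_multiple_of_pi:
  assumes "angle b = real j * pi"
  shows "P b = 0"
proof -
  obtain \<rho> where "B b = - \<rho> * sin (angle b)"
    using polar[of b] a_less_b by auto
  then show ?thesis using a_nonneg a_less_b by (simp add: assms momentum_def)
qed

lemma angle_less_pi:
  assumes "\<And>r. r \<in> {a..b} \<Longrightarrow> A r > 0"
  shows "angle b < pi"
proof (rule ccontr)
  assume "\<not> angle b < pi"
  then have "pi / 2 \<le> angle b" using pi_gt_zero by linarith
  then have "\<exists>r\<ge>a. r \<le> b \<and> angle r = pi / 2"
    using a_less_b cont_angle by (intro IVT') auto
  then obtain r where r: "r \<in> {a..b}" "angle r = pi / 2" by auto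
  have "cos (angle r) = 0" unfolding r(2) by (rule cos_pi_half)
  then have "A r = 0" using A_zero_iff r(1) by blast
  then show False using assms[of r] r by simp
qed

lemma A_near_start:
  assumes "\<And>x. \<bar>h x\<bar> \<le> H" and r: "r \<in> {a..b}"
  shows "\<bar>A r - 1\<bar> \<le> H * (b - a)"
proof -
  have H: "H \<ge> 0" using assms(1)[of 0] by simp
  have "norm (integral {a..r} (\<lambda>s. h (P s))) \<le> integral {a..r} (\<lambda>_. H)"
    using r assms(1)
    by (intro integral_norm_bound_integral integrable_continuous_real continuous_on_const
        continuous_on_subset[OF cont_hP]) auto
  also have "\<dots> = (r - a) * H" using r by simp
  also have "\<dots> \<le> (b - a) * H" using r H by (intro mult_right_mono) auto
  finally show ?thesis
    using solves r by (auto simp: solves_def picard_def flux_def mult.commute)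
qed

end

section \<open>Shooting for the curvature equation\<close>

text \<open>Solutions with initial value \<open>1 + e\<close> are written as \<open>1 + e * A\<close>. The equation for \<open>A\<close>,
  with \<open>A a = 1\<close>, has a meaning also for \<open>e = 0\<close>, where it is the linearization at the constant
  solution \<open>1\<close>. The number \<open>M\<close> is a bound for the solutions that matter.\<close>

locale minkowski_shooting = radial_interval +
  fixes p q M :: real
  assumes p_ge: "2 \<le> p" and p_le_q: "p \<le> q" and M_gt: "M > 1"
begin

definition nonlin :: "real \<Rightarrow> real" where
  "nonlin s = s powr (q - 1) - s powr (p - 1)"

text \<open>The nonlinearity is extended by constants outside \<open>{0..M}\<close> to become globally Lipschitz. On the
  negative axis the extension is \<open>0\<close>, so every nonpositive constant is an equilibrium.\<close>

definition trunc :: "real \<Rightarrow> real" where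
  "trunc s = nonlin (min M (max 0 s))"

text \<open>The difference quotient of \<open>trunc\<close> at its zero \<open>1\<close>; the value at \<open>0\<close> is the derivative there.\<close>

definition slope :: "real \<Rightarrow> real" where
  "slope y = (if y = 0 then q - p else trunc (1 + y) / y)"

text \<open>The rescaled velocity \<open>h (e * x) / e\<close> for \<open>h x = x / sqrt (1 + x\<^sup>2)\<close>, and the rescaled force
  \<open>trunc (1 + e * x) / e\<close>, both written without division by \<open>e\<close>. At \<open>e = 0\<close> they are the
  identity and multiplication by \<open>q - p\<close>.\<close>

definition rescaled_velocity :: "real \<Rightarrow> real \<Rightarrow> real" where
  "rescaled_velocity e x = x / sqrt (1 + (e * x)\<^sup>2)"

definition rescaled_force :: "real \<Rightarrow> real \<Rightarrow> real" where
  "rescaled_force e x = slope (e * x) * x"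

definition lip :: real where
  "lip = (q - 1) * M powr (q - 2) + (p - 1) * M powr (p - 2)"

lemma nonlin_lipschitz:
  assumes "0 \<le> x" "x \<le> M" "0 \<le> y" "y \<le> M"
  shows "\<bar>nonlin x - nonlin y\<bar> \<le> lip * \<bar>x - y\<bar>"
proof -
  have *: "\<bar>nonlin y - nonlin x\<bar> \<le> lip * \<bar>y - x\<bar>" if xy: "0 \<le> x" "x < y" "y \<le> M" for x y
  proof -
    have "continuous_on {x..y} nonlin"
      unfolding nonlin_def using xy p_ge p_le_q
      by (intro continuous_on_diff continuous_on_powr' continuous_on_id continuous_on_const) auto
    moreover have d: "(nonlin has_real_derivative ((q - 1) * z powr (q - 2) - (p - 1) * z powr (p - 2))) (at z)"
      if "x < z" "z < y" for z
      unfolding nonlin_def using that xy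
      by (auto intro!: derivative_eq_intros)
    ultimately obtain z where z: "x < z" "z < y"
      "nonlin y - nonlin x = ((q - 1) * z powr (q - 2) - (p - 1) * z powr (p - 2)) * (y - x)"
      using mvt[OF \<open>x < y\<close>, of nonlin "\<lambda>z h. ((q - 1) * z powr (q - 2) - (p - 1) * z powr (p - 2)) * h"]
      by (auto simp: has_field_derivative_def)
    have "z powr (q - 2) \<le> M powr (q - 2)" "z powr (p - 2) \<le> M powr (p - 2)"
      using z xy p_ge p_le_q by (auto intro!: powr_mono2)
    then have "(q - 1) * z powr (q - 2) \<le> (q - 1) * M powr (q - 2)" "(p - 1) * z powr (p - 2) \<le> (p - 1) * M powr (p - 2)"
      using p_ge p_le_q by (auto intro!: mult_left_mono)
    moreover have "(q - 1) * z powr (q - 2) \<ge> 0" "(p - 1) * z powr (p - 2) \<ge> 0"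
      using p_ge p_le_q by auto
    ultimately have "\<bar>(q - 1) * z powr (q - 2) - (p - 1) * z powr (p - 2)\<bar> \<le> lip"
      unfolding lip_def by linarith
    then show ?thesis
      unfolding z(3) abs_mult by (rule mult_right_mono) simp
  qed
  show ?thesis
  proof (cases x y rule: linorder_cases)
    case less
    then show ?thesis using *[of x y] assms by (simp add: abs_minus_commute)
  next
    case greater
    then show ?thesis using *[of y x] assms by simp
  qed simp
qed

lemma lip_ge: "lip \<ge> q - p"
proof -
  have "1 \<le> M powr (q - 2)" using M_gt p_ge p_le_q by (intro ge_one_powr_ge_zero) auto
  then have "(q - 1) * 1 \<le> (q - 1) * M powr (q - 2)" using p_ge p_le_q by (intro mult_left_mono) auto
  moreover have "(p - 1) * M powr (p - 2) \<ge> 0" using p_ge by simp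
  ultimately have "(q - 1) * 1 + 0 \<le> lip" unfolding lip_def by (rule add_mono)
  then show ?thesis using p_ge by simp
qed

lemma lip_pos: "lip > 0"
  using p_ge p_le_q M_gt unfolding lip_def by (intro add_pos_pos mult_pos_pos) auto

lemma trunc_lipschitz: "\<bar>trunc x - trunc y\<bar> \<le> lip * \<bar>x - y\<bar>"
proof -
  have "\<bar>trunc x - trunc y\<bar> \<le> lip * \<bar>min M (max 0 x) - min M (max 0 y)\<bar>"
    unfolding trunc_def using M_gt by (intro nonlin_lipschitz) auto
  also have "\<dots> \<le> lip * \<bar>x - y\<bar>"
    using lip_pos by (intro mult_left_mono) (auto simp: min_def max_def)
  finally show ?thesis .
qed

lemma trunc_1 [simp]: "trunc 1 = 0"
  using M_gt by (simp add: trunc_def nonlin_def)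

lemma trunc_nonpos: "s \<le> 0 \<Longrightarrow> trunc s = 0"
  using M_gt by (simp add: trunc_def nonlin_def max_def min_def)

lemma trunc_eq: "0 \<le> s \<Longrightarrow> s \<le> M \<Longrightarrow> trunc s = s powr (q - 1) - s powr (p - 1)"
  by (simp add: trunc_def nonlin_def)

lemma trunc_sign: "(s - 1) * trunc s \<ge> 0"
proof -
  define t where "t = min M (max 0 s)"
  have t: "trunc s = t powr (q - 1) - t powr (p - 1)" by (simp add: trunc_def nonlin_def t_def)
  show ?thesis
  proof (cases "s \<ge> 1")
    case True
    then have "t \<ge> 1" using M_gt by (simp add: t_def)
    then have "t powr (p - 1) \<le> t powr (q - 1)" using p_le_q by (intro powr_mono) auto
    then show ?thesis using True t by (intro mult_nonneg_nonneg) auto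
  next
    case False
    then have "0 \<le> t" "t \<le> 1" using M_gt by (auto simp: t_def)
    then have "t powr (q - 1) \<le> t powr (p - 1)" using p_le_q by (intro powr_mono') auto
    then show ?thesis using False t by (intro mult_nonpos_nonpos) auto
  qed
qed

lemma slope_nonneg: "slope y \<ge> 0"
  using trunc_sign[of "1 + y"] p_le_q
  by (auto simp: slope_def zero_le_mult_iff zero_le_divide_iff)

lemma continuous_trunc: "continuous_on UNIV trunc"
  by (rule lipschitz_on_continuous_on[of lip], rule lipschitz_onI)
    (use trunc_lipschitz lip_pos in \<open>auto simp: dist_real_def\<close>)

lemma continuous_slope: "continuous_on UNIV slope"
proof -
  have "isCont slope y" for y
  proof (cases "y = 0")
    case True
    have "(nonlin has_real_derivative (q - p)) (at 1)"
      unfolding nonlin_def by (auto intro!: derivative_eq_intros)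
    then have "((\<lambda>h. (nonlin (1 + h) - nonlin 1) / h) \<longlongrightarrow> q - p) (at 0)"
      by (simp add: DERIV_def)
    moreover have "\<forall>\<^sub>F h in at 0. (nonlin (1 + h) - nonlin 1) / h = slope h"
    proof -
      have "\<forall>\<^sub>F h in at 0. h \<in> {-1<..<M - 1}" 
        using M_gt by (intro eventually_at_in_open') auto
      moreover have "\<forall>\<^sub>F h in at (0::real). h \<noteq> 0" by (simp add: eventually_at_filter)
      ultimately show ?thesis
        by eventually_elim (simp add: slope_def trunc_def, simp add: nonlin_def)
    qed
    ultimately have "(slope \<longlongrightarrow> q - p) (at 0)" by (rule Lim_transform_eventually)
    then show ?thesis using True by (simp add: isCont_def slope_def)
  next
    case False
    have "isCont trunc (1 + y)"
      using continuous_trunc continuous_on_eq_continuous_at[OF open_UNIV] by blast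
    then have "isCont (\<lambda>y. trunc (1 + y)) y"
      by (rule isCont_o2[rotated]) (rule continuous_intros)+
    then have "isCont (\<lambda>y. trunc (1 + y) / y) y"
      using False by (rule isCont_divide[OF _ continuous_ident])
    moreover have "\<forall>\<^sub>F y in nhds y. trunc (1 + y) / y = slope y"
      using t1_space_nhds[OF False] by eventually_elim (simp add: slope_def)
    ultimately show ?thesis by (rule isCont_cong[THEN iffD1, rotated])
  qed
  then show ?thesis by (simp add: continuous_at_imp_continuous_on)
qed

lemma e_rescaled_force: "e * rescaled_force e x = trunc (1 + e * x)"
  by (simp add: rescaled_force_def slope_def)

lemma rescaled_force_lipschitz: "lip-lipschitz_on UNIV (rescaled_force e)"
proof (rule lipschitz_onI)
  fix x y
  show "dist (rescaled_force e x) (rescaled_force e y) \<le> lip * dist x y"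
  proof (cases "e = 0")
    case True
    have "dist (rescaled_force e x) (rescaled_force e y) = (q - p) * dist x y"
      using True p_le_q by (simp add: rescaled_force_def slope_def dist_real_def abs_mult flip: right_diff_distrib)
    also have "\<dots> \<le> lip * dist x y" using lip_ge by (intro mult_right_mono) auto
    finally show ?thesis .
  next
    case False
    have "\<bar>e\<bar> * dist (rescaled_force e x) (rescaled_force e y) = \<bar>trunc (1 + e * x) - trunc (1 + e * y)\<bar>"
      by (simp add: dist_real_def abs_mult[symmetric] right_diff_distrib e_rescaled_force)
    also have "\<dots> \<le> lip * \<bar>e * x - e * y\<bar>" using trunc_lipschitz[of "1 + e * x" "1 + e * y"] by simp
    also have "\<dots> = \<bar>e\<bar> * (lip * dist x y)" by (simp add: dist_real_def abs_mult flip: right_diff_distrib)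
    finally show ?thesis using False by simp
  qed
qed (use lip_pos in simp)

lemma rescaled_velocity_deriv:
  "(rescaled_velocity e has_real_derivative 1 / ((1 + (e * x)\<^sup>2) * sqrt (1 + (e * x)\<^sup>2))) (at x)"
proof -
  define s where "s = sqrt (1 + (e * x)\<^sup>2)"
  have pos: "1 + (e * x)\<^sup>2 > 0" by (simp add: add_pos_nonneg)
  then have s: "s > 0" "s\<^sup>2 = 1 + (e * x)\<^sup>2" by (simp_all add: s_def)
  have "(rescaled_velocity e has_real_derivative (s - x * (e * (e * x)) / s) / s\<^sup>2) (at x)"
    unfolding rescaled_velocity_def s_def using pos
    by (auto intro!: derivative_eq_intros simp: power2_eq_square field_simps)
  moreover have "(s - x * (e * (e * x)) / s) / s\<^sup>2 = 1 / (s\<^sup>2 * s)"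
  proof -
    have "s - x * (e * (e * x)) / s = (s\<^sup>2 - (e * x)\<^sup>2) / s"
      using s(1) by (simp add: field_simps power2_eq_square)
    also have "\<dots> = 1 / s" by (simp add: s(2))
    finally show ?thesis using s(1) by simp
  qed
  ultimately show ?thesis by (simp add: s(2)) (simp add: s_def)
qed

lemma rescaled_velocity_lipschitz: "1-lipschitz_on UNIV (rescaled_velocity e)"
proof (rule lipschitz_onI)
  fix x y
  have "norm (rescaled_velocity e x - rescaled_velocity e y) \<le> 1 * norm (x - y)"
  proof (rule field_differentiable_bound[OF convex_UNIV])
    fix z :: real
    show "(rescaled_velocity e has_real_derivative 1 / ((1 + (e * z)\<^sup>2) * sqrt (1 + (e * z)\<^sup>2))) (at z within UNIV)"
      using rescaled_velocity_deriv by simp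
    have "1 * 1 \<le> (1 + (e * z)\<^sup>2) * sqrt (1 + (e * z)\<^sup>2)" by (intro mult_mono) auto
    then show "norm (1 / ((1 + (e * z)\<^sup>2) * sqrt (1 + (e * z)\<^sup>2))) \<le> 1" by (simp add: divide_le_eq)
  qed auto
  then show "dist (rescaled_velocity e x) (rescaled_velocity e y) \<le> 1 * dist x y" by (simp add: dist_norm)
qed simp

lemma sqrt_arg_pos: "sqrt (1 + (e * x)\<^sup>2) > (0::real)"
  by (simp add: add_pos_nonneg)

text \<open>This is the bound \<open>\<bar>u'\<bar> \<le> 1\<close> on the gradient after rescaling.\<close>

lemma rescaled_velocity_bound: "e \<noteq> 0 \<Longrightarrow> \<bar>rescaled_velocity e x\<bar> \<le> 1 / \<bar>e\<bar>"
proof -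
  assume e: "e \<noteq> 0"
  have "\<bar>e * x\<bar> \<le> sqrt (1 + (e * x)\<^sup>2)" by (rule real_le_rsqrt) simp
  then have "\<bar>e\<bar> * \<bar>rescaled_velocity e x\<bar> \<le> 1"
    using sqrt_arg_pos[of e x] by (simp add: rescaled_velocity_def abs_mult divide_le_eq)
  then show ?thesis using e by (simp add: field_simps)
qed

definition rescaled_profile :: "real \<Rightarrow> real \<Rightarrow> real" where
  "rescaled_profile e = (SOME A. solves (rescaled_velocity e) (rescaled_force e) A)"

lemma rescaled_profile_oscillation: "monotone_oscillation m a b (rescaled_velocity e) (rescaled_force e) lip (rescaled_profile e)"
proof unfold_locales
  show "solves (rescaled_velocity e) (rescaled_force e) (rescaled_profile e)"
    unfolding rescaled_profile_def
    by (rule someI_ex[OF solves_exists[OF rescaled_velocity_lipschitz rescaled_force_lipschitz lip_pos]])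
  show "x * rescaled_force e x \<ge> 0" for x
  proof -
    have "x * rescaled_force e x = slope (e * x) * x\<^sup>2" by (simp add: rescaled_force_def power2_eq_square)
    then show ?thesis using slope_nonneg by simp
  qed
  show "x * rescaled_velocity e x > 0" if "x \<noteq> 0" for x
  proof -
    have "x * rescaled_velocity e x = x\<^sup>2 / sqrt (1 + (e * x)\<^sup>2)" by (simp add: rescaled_velocity_def power2_eq_square)
    then show ?thesis using that sqrt_arg_pos[of e x] by simp
  qed
qed (use rescaled_velocity_lipschitz rescaled_force_lipschitz lip_pos in \<open>auto simp: rescaled_velocity_def rescaled_force_def\<close>)

lemma rescaled_profile_family: "oscillating_family m a b UNIV rescaled_velocity rescaled_force lip rescaled_profile"
proof (intro oscillating_family.intro oscillating_family_axioms.intro radial_interval_axioms)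
  show "oscillating_solution m a b (rescaled_velocity e) (rescaled_force e) lip (rescaled_profile e)" for e
    using rescaled_profile_oscillation[of e] by (simp add: monotone_oscillation_def)
  have "continuous_on UNIV (\<lambda>z::real \<times> real. slope (fst z * snd z) * snd z)"
    by (intro continuous_intros continuous_on_compose2[OF continuous_slope]) auto
  then show "continuous_on (UNIV \<times> UNIV) (\<lambda>(e, x). rescaled_force e x)"
    by (simp add: rescaled_force_def case_prod_beta)
  have "sqrt (1 + (fst z * snd z)\<^sup>2) \<noteq> 0" for z :: "real \<times> real"
    using sqrt_arg_pos[of "fst z" "snd z"] by simp
  then have "continuous_on UNIV (\<lambda>z::real \<times> real. snd z / sqrt (1 + (fst z * snd z)\<^sup>2))"
    by (intro continuous_intros) auto
  then show "continuous_on (UNIV \<times> UNIV) (\<lambda>(e, x). rescaled_velocity e x)"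
    by (simp add: rescaled_velocity_def case_prod_beta)
qed

definition rot :: "real \<Rightarrow> real" where
  "rot e = oscillating_solution.angle m a (rescaled_velocity e) (rescaled_force e) (rescaled_profile e) b"

lemma continuous_rot: "continuous_on X rot"
  using oscillating_family.continuous_rotation[OF rescaled_profile_family]
  unfolding oscillating_family.rotation_def[OF rescaled_profile_family] rot_def[symmetric]
  by (auto elim: continuous_on_subset)

text \<open>For \<open>e = -1\<close> the shooting solution is the constant \<open>0\<close>, which is an equilibrium.\<close>

lemma rot_minus_one: "rot (-1) = 0"
proof -
  interpret s: monotone_oscillation m a b "rescaled_velocity (-1)" "rescaled_force (-1)" lip "rescaled_profile (-1)"
    by (rule rescaled_profile_oscillation)
  have g1: "rescaled_force (-1) 1 = 0" by (simp add: rescaled_force_def slope_def trunc_nonpos)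
  have "solves (rescaled_velocity (-1)) (rescaled_force (-1)) (\<lambda>_. 1)"
    by (simp add: solves_def picard_def g1 avg_def s.h_0)
  then have one: "rescaled_profile (-1) r = 1" if "r \<in> {a..b}" for r
    using solves_unique[OF rescaled_velocity_lipschitz rescaled_force_lipschitz lip_pos s.solves _ that] by simp
  have "s.spin r = 0" if r: "r \<in> {a..b}" for r
  proof -
    have "s.P r = flux (rescaled_force (-1)) (\<lambda>_. 1) r"
      using one r by (intro flux_cong) auto
    then have "s.P r = 0" by (simp add: flux_def avg_def g1)
    then show ?thesis by (simp add: s.spin_def one[OF r] g1 momentum_def)
  qed
  then have "integral {a..b} s.spin = integral {a..b} (\<lambda>_. 0)" by (intro integral_cong) auto
  then show ?thesis by (simp add: rot_def s.angle_def)
qed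

text \<open>A solution of slope at most \<open>1\<close> cannot descend from \<open>1 + e\<close> to \<open>1\<close> within a distance smaller
  than \<open>e\<close>.\<close>

lemma rot_large: "rot (b - a + 1) < pi"
proof -
  define E where "E = b - a + 1"
  have E: "E > b - a" "E > 0" using a_less_b by (simp_all add: E_def)
  interpret s: monotone_oscillation m a b "rescaled_velocity E" "rescaled_force E" lip "rescaled_profile E"
    by (rule rescaled_profile_oscillation)
  have "rescaled_profile E r > 0" if "r \<in> {a..b}" for r
  proof -
    have "\<bar>rescaled_profile E r - 1\<bar> \<le> 1 / \<bar>E\<bar> * (b - a)"
      by (rule s.A_near_start[OF rescaled_velocity_bound that]) (use E in simp)
    also have "\<dots> < 1" using E by (simp add: divide_less_eq)
    finally show ?thesis by simp
  qed
  then show ?thesis using s.angle_less_pi by (simp add: rot_def E_def)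
qed

definition shoot :: "real \<Rightarrow> real \<Rightarrow> real" where
  "shoot e r = 1 + e * rescaled_profile e r"

lemma shoot_near_start:
  assumes "r \<in> {a..b}"
  shows "\<bar>shoot e r - (1 + e)\<bar> \<le> b - a"
proof (cases "e = 0")
  case True
  then show ?thesis using a_less_b by (simp add: shoot_def)
next
  case False
  interpret s: monotone_oscillation m a b "rescaled_velocity e" "rescaled_force e" lip "rescaled_profile e"
    by (rule rescaled_profile_oscillation)
  have "\<bar>rescaled_profile e r - 1\<bar> \<le> 1 / \<bar>e\<bar> * (b - a)"
    by (rule s.A_near_start[OF rescaled_velocity_bound[OF False] assms])
  then have "\<bar>e\<bar> * \<bar>rescaled_profile e r - 1\<bar> \<le> b - a" using False by (simp add: field_simps)
  moreover have "shoot e r - (1 + e) = e * (rescaled_profile e r - 1)" by (simp add: shoot_def algebra_simps)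
  ultimately show ?thesis by (simp add: abs_mult)
qed

text \<open>At a minimum point with nonpositive value the flux vanishes, by the Neumann condition if it is
  the right end. As \<open>trunc\<close> vanishes there, the solution meets an equilibrium, which is impossible
  by \<open>equilibrium_unreachable\<close>.\<close>

lemma shoot_positive:
  assumes e: "e > -1" and rot: "rot e = real j * pi" and r: "r \<in> {a..b}"
  shows "shoot e r > 0"
proof (cases "e = 0")
  case True
  then show ?thesis by (simp add: shoot_def)
next
  case False
  interpret s: monotone_oscillation m a b "rescaled_velocity e" "rescaled_force e" lip "rescaled_profile e"
    by (rule rescaled_profile_oscillation)
  have "continuous_on {a..b} (shoot e)" unfolding shoot_def by (intro continuous_intros s.cont_A)
  then obtain r0 where r0: "r0 \<in> {a..b}" and min: "\<And>t. t \<in> {a..b} \<Longrightarrow> shoot e r0 \<le> shoot e t"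
    using continuous_attains_inf[of "{a..b}" "shoot e"] a_less_b by auto
  have "shoot e r0 > 0"
  proof (rule ccontr)
    assume np: "\<not> shoot e r0 > 0"
    have "shoot e a = 1 + e" by (simp add: shoot_def)
    then have r0_ne: "r0 \<noteq> a" using np e by auto
    have "e * rescaled_force e (rescaled_profile e r0) = 0"
      using np trunc_nonpos[of "shoot e r0"] by (simp add: e_rescaled_force shoot_def)
    then have g0: "rescaled_force e (rescaled_profile e r0) = 0" using False by simp
    have P0: "s.P r0 = 0"
    proof (cases "r0 = b")
      case True
      then show ?thesis using s.flux_zero_at_multiple_of_pi[of j] rot by (simp add: rot_def)
    next
      case ne: False
      then have r0': "r0 \<in> {a<..<b}" using r0 r0_ne by auto
      have "(shoot e has_real_derivative e * rescaled_velocity e (s.P r0)) (at r0)"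
        unfolding shoot_def by (rule derivative_eq_intros refl s.A_deriv[OF r0'])+ simp
      moreover have "\<forall>t. \<bar>r0 - t\<bar> < min (r0 - a) (b - r0) \<longrightarrow> shoot e r0 \<le> shoot e t"
        using min by (auto simp: abs_if split: if_splits)
      ultimately have "e * rescaled_velocity e (s.P r0) = 0"
        using r0' by (intro DERIV_local_min[where d = "min (r0 - a) (b - r0)"]) auto
      then show ?thesis using False sqrt_arg_pos[of e "s.P r0"] by (simp add: rescaled_velocity_def)
    qed
    have "rescaled_profile e r0 = 1"
      by (rule s.equilibrium_unreachable[OF g0 _ refl P0]) (use r0 r0_ne in auto)
    then show False using np e by (simp add: shoot_def)
  qed
  then show ?thesis using min[OF r] by simp
qed

lemma card_shoot_zeros:
  assumes "e \<noteq> 0" "rot e = real j * pi"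
  shows "card {r \<in> {a<..<b}. shoot e r - 1 = 0} = j"
proof -
  interpret s: monotone_oscillation m a b "rescaled_velocity e" "rescaled_force e" lip "rescaled_profile e"
    by (rule rescaled_profile_oscillation)
  have "{r \<in> {a<..<b}. shoot e r - 1 = 0} = {r \<in> {a<..<b}. rescaled_profile e r = 0}"
    using assms by (auto simp: shoot_def)
  then show ?thesis using s.card_zeros[of j] assms by (simp add: rot_def)
qed

lemma shoot_left_end: "shoot e a = 1 + e"
proof -
  interpret s: monotone_oscillation m a b "rescaled_velocity e" "rescaled_force e" lip "rescaled_profile e"
    by (rule rescaled_profile_oscillation)
  show ?thesis by (simp add: shoot_def)
qed

definition shoot_flux :: "real \<Rightarrow> real \<Rightarrow> real" where
  "shoot_flux e r = - avg (\<lambda>t. trunc (shoot e t)) r"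

lemma shoot_flux_eq: "shoot_flux e r = e * flux (rescaled_force e) (rescaled_profile e) r"
proof -
  have "integral {a..r} (\<lambda>t. t ^ m * trunc (shoot e t)) = integral {a..r} (\<lambda>t. e * (t ^ m * rescaled_force e (rescaled_profile e t)))"
    by (simp add: shoot_def mult.left_commute flip: e_rescaled_force)
  then show ?thesis by (simp add: shoot_flux_def flux_def avg_def)
qed

lemma shoot_deriv:
  assumes "r \<in> {a..b}"
  shows "(shoot e has_real_derivative shoot_flux e r / sqrt (1 + (shoot_flux e r)\<^sup>2)) (at r within {a..b})"
proof -
  interpret s: monotone_oscillation m a b "rescaled_velocity e" "rescaled_force e" lip "rescaled_profile e"
    by (rule rescaled_profile_oscillation)
  have "(shoot e has_real_derivative e * rescaled_velocity e (s.P r)) (at r within {a..b})"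
    unfolding shoot_def by (rule derivative_eq_intros refl s.A_deriv_within[OF assms])+ simp
  then show ?thesis by (simp add: rescaled_velocity_def shoot_flux_eq)
qed

lemma shoot_flux_right_end:
  assumes "rot e = real j * pi"
  shows "shoot_flux e b = 0"
proof -
  interpret s: monotone_oscillation m a b "rescaled_velocity e" "rescaled_force e" lip "rescaled_profile e"
    by (rule rescaled_profile_oscillation)
  show ?thesis using s.flux_zero_at_multiple_of_pi[of j] assms by (simp add: rot_def shoot_flux_eq)
qed

end

section \<open>Radial vector fields\<close>

text \<open>The orthogonal projection to the line through \<open>x\<close>; it is \<open>0\<close> for \<open>x = 0\<close>.\<close>

definition sgn_projection :: "'a::euclidean_space \<Rightarrow> 'a \<Rightarrow>\<^sub>L 'a" where
  "sgn_projection x = blinfun_scaleR_left (sgn x) o\<^sub>L blinfun_inner_left (sgn x)"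

lemma sgn_projection_apply: "blinfun_apply (sgn_projection x) h = (h \<bullet> sgn x) *\<^sub>R sgn x"
  by (simp add: sgn_projection_def)

lemma norm_sgn_projection_le: "norm (sgn_projection x) \<le> 1"
proof (rule norm_blinfun_bound)
  fix h :: 'a
  have "\<bar>h \<bullet> sgn x\<bar> \<le> norm h * norm (sgn x)" by (rule Cauchy_Schwarz_ineq2)
  also have "\<dots> \<le> norm h * 1" by (intro mult_left_mono) (auto simp: norm_sgn)
  finally have "\<bar>h \<bullet> sgn x\<bar> \<le> norm h" by simp
  then have "\<bar>h \<bullet> sgn x\<bar> * norm (sgn x) \<le> norm h * 1" by (intro mult_mono) (auto simp: norm_sgn)
  then show "norm (blinfun_apply (sgn_projection x) h) \<le> 1 * norm h"
    by (simp add: sgn_projection_apply)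
qed simp

text \<open>Vector fields of the form \<open>c (norm x) *\<^sub>R x\<close>. Both the gradient of a radial function and its
  normalization by the Lorentz factor have this form. The derivative of \<open>c\<close> enters through
  \<open>\<epsilon> r = r * c' r\<close>, which stays continuous up to the centre of a ball while \<open>c'\<close> need not.\<close>

locale radial_field = radial_interval m a b for m a b +
  fixes c \<epsilon> :: "real \<Rightarrow> real"
  assumes cont_c: "continuous_on {a..b} c" and cont_\<epsilon>: "continuous_on {a..b} \<epsilon>"
    and c_deriv: "r \<in> {a<..<b} \<Longrightarrow> (c has_real_derivative \<epsilon> r / r) (at r)"
    and \<epsilon>_0: "a = 0 \<Longrightarrow> \<epsilon> 0 = 0"
begin

definition field :: "'a::euclidean_space \<Rightarrow> 'a" where
  "field x = c (norm x) *\<^sub>R x"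

definition field_deriv :: "'a::euclidean_space \<Rightarrow> 'a \<Rightarrow>\<^sub>L 'a" where
  "field_deriv x = c (norm x) *\<^sub>R id_blinfun + \<epsilon> (norm x) *\<^sub>R sgn_projection x"

lemma continuous_field: "continuous_on {x::'a::euclidean_space. norm x \<in> {a..b}} field"
  unfolding field_def by (intro continuous_intros continuous_on_compose2[OF cont_c]) auto

text \<open>The projection jumps at the origin, but its factor tends to \<open>0\<close> there.\<close>

lemma continuous_field_deriv: "continuous_on {x::'a::euclidean_space. norm x \<in> {a..b}} field_deriv"
proof -
  let ?X = "{x::'a. norm x \<in> {a..b}}"
  have ce: "continuous_on ?X (\<lambda>x. \<epsilon> (norm x))"
    by (intro continuous_intros continuous_on_compose2[OF cont_\<epsilon>]) auto
  have "continuous (at x within ?X) (\<lambda>x. \<epsilon> (norm x) *\<^sub>R sgn_projection x)" if x: "x \<in> ?X" for x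
  proof (cases "x = 0")
    case True
    then have a: "a = 0" using x a_nonneg by simp
    have "((\<lambda>x. \<epsilon> (norm x)) \<longlongrightarrow> \<epsilon> (norm x)) (at x within ?X)"
      using ce x by (simp add: continuous_on_def)
    then have "((\<lambda>x. \<bar>\<epsilon> (norm x)\<bar>) \<longlongrightarrow> 0) (at x within ?X)"
      using True \<epsilon>_0[OF a] tendsto_rabs_zero by fastforce
    then have "((\<lambda>x. \<epsilon> (norm x) *\<^sub>R sgn_projection x) \<longlongrightarrow> 0) (at x within ?X)"
    proof (rule Lim_null_comparison[rotated])
      have "norm (\<epsilon> (norm y) *\<^sub>R sgn_projection y) \<le> \<bar>\<epsilon> (norm y)\<bar>" for y :: 'a
        using mult_left_mono[OF norm_sgn_projection_le[of y], of "\<bar>\<epsilon> (norm y)\<bar>"] by simp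
      then show "\<forall>\<^sub>F y in at x within ?X. norm (\<epsilon> (norm y) *\<^sub>R sgn_projection y) \<le> \<bar>\<epsilon> (norm y)\<bar>"
        by simp
    qed
    then show ?thesis using True \<epsilon>_0[OF a] by (simp add: continuous_within)
  next
    case False
    have "continuous (at x within ?X) (\<lambda>x. \<epsilon> (norm x))"
      using ce x by (simp add: continuous_on_eq_continuous_within)
    moreover have sg: "continuous (at x within ?X) (\<lambda>x. sgn x)"
      using False by (intro continuous_intros) auto
    ultimately show ?thesis
      unfolding sgn_projection_def using False
      by (intro continuous_intros bounded_linear.continuous[OF bounded_linear_blinfun_scaleR_left]
          bounded_linear.continuous[OF bounded_linear_blinfun_inner_left]
          bounded_bilinear.continuous[OF bounded_bilinear_blinfun_compose])
  qed
  then have "continuous_on ?X (\<lambda>x. \<epsilon> (norm x) *\<^sub>R sgn_projection x)"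
    by (simp add: continuous_on_eq_continuous_within)
  moreover have "continuous_on ?X (\<lambda>x. c (norm x) *\<^sub>R (id_blinfun :: 'a \<Rightarrow>\<^sub>L 'a))"
    by (intro continuous_intros continuous_on_compose2[OF cont_c]) auto
  ultimately show ?thesis unfolding field_deriv_def by (intro continuous_on_add)
qed

text \<open>At the origin the field is \<open>c 0 *\<^sub>R x\<close> up to an error of smaller order, by continuity of \<open>c\<close>.\<close>

lemma field_has_derivative:
  fixes x :: "'a::euclidean_space"
  assumes x: "norm x \<in> {a<..<b} \<or> a = 0 \<and> x = 0"
  shows "(field has_derivative blinfun_apply (field_deriv x)) (at x)"
proof (cases "x = 0")
  case False
  then have r: "norm x \<in> {a<..<b}" using x by auto
  have dn: "(norm has_derivative (\<lambda>h. h \<bullet> sgn x)) (at x)"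
    using has_derivative_norm[OF False] .
  have "((\<lambda>x. c (norm x)) has_derivative (\<lambda>h. \<epsilon> (norm x) / norm x * (h \<bullet> sgn x))) (at x)"
    by (rule has_derivative_compose[OF dn c_deriv[OF r, unfolded has_field_derivative_def]])
  then have "(field has_derivative (\<lambda>h. c (norm x) *\<^sub>R h + (\<epsilon> (norm x) / norm x * (h \<bullet> sgn x)) *\<^sub>R x)) (at x)"
    unfolding field_def by (intro has_derivative_scaleR has_derivative_ident)
  moreover have "(\<epsilon> (norm x) / norm x * (h \<bullet> sgn x)) *\<^sub>R x = \<epsilon> (norm x) *\<^sub>R ((h \<bullet> sgn x) *\<^sub>R sgn x)" for h
    by (simp add: sgn_div_norm divide_inverse mult_ac)
  then have "blinfun_apply (field_deriv x)
      = (\<lambda>h. c (norm x) *\<^sub>R h + (\<epsilon> (norm x) / norm x * (h \<bullet> sgn x)) *\<^sub>R x)"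
    by (intro ext) (simp add: field_deriv_def blinfun.add_left blinfun.scaleR_left sgn_projection_apply)
  ultimately show ?thesis by simp
next
  case True
  then have a: "a = 0" using x a_nonneg by auto
  have "isCont (\<lambda>x::'a. c (norm x)) 0"
  proof -
    have "continuous_on (ball 0 b) (\<lambda>x::'a. c (norm x))"
      using a by (intro continuous_intros continuous_on_compose2[OF cont_c]) auto
    then show ?thesis using a_less_b a by (simp add: continuous_on_eq_continuous_at)
  qed
  then have "((\<lambda>h::'a. c (norm h)) \<longlongrightarrow> c 0) (at 0)" by (simp add: isCont_def)
  then have "((\<lambda>h::'a. c (norm h) - c 0) \<longlongrightarrow> 0) (at 0)" by (rule LIM_zero)
  then have lim: "((\<lambda>h::'a. \<bar>c (norm h) - c 0\<bar>) \<longlongrightarrow> 0) (at 0)" by (rule tendsto_rabs_zero)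
  have "(field has_derivative (\<lambda>h. c 0 *\<^sub>R h)) (at (0::'a))"
  proof (rule has_derivativeI)
    show "bounded_linear (\<lambda>h::'a. c 0 *\<^sub>R h)" by (rule bounded_linear_scaleR_right)
    have "norm (field y - field 0 - c 0 *\<^sub>R (y - 0)) / norm (y - 0) = \<bar>c (norm y) - c 0\<bar>" if "y \<noteq> 0" for y :: 'a
      using that by (simp add: field_def flip: scaleR_diff_left)
    then have ev: "\<forall>\<^sub>F y in at (0::'a). \<bar>c (norm y) - c 0\<bar> =
        norm ((field y - field 0 - c 0 *\<^sub>R (y - 0)) /\<^sub>R norm (y - 0))"
      by (simp add: eventually_at_filter divide_inverse mult.commute)
    have "((\<lambda>y. norm ((field y - field 0 - c 0 *\<^sub>R (y - 0)) /\<^sub>R norm (y - 0))) \<longlongrightarrow> 0) (at (0::'a))"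
      by (rule Lim_transform_eventually[OF lim ev])
    then show "((\<lambda>y. (field y - field 0 - c 0 *\<^sub>R (y - 0)) /\<^sub>R norm (y - 0)) \<longlongrightarrow> 0) (at (0::'a))"
      by (rule tendsto_norm_zero_cancel)
  qed
  moreover have "blinfun_apply (field_deriv x) = (\<lambda>h. c 0 *\<^sub>R h)"
    using True \<epsilon>_0[OF a]
    by (intro ext) (simp add: field_deriv_def blinfun.add_left blinfun.scaleR_left sgn_projection_apply)
  ultimately show ?thesis using True by simp
qed

lemma trace_field_deriv:
  fixes x :: "'a::euclidean_space"
  assumes "norm x \<in> {a<..<b} \<or> a = 0 \<and> x = 0"
  shows "(\<Sum>i\<in>Basis. blinfun_apply (field_deriv x) i \<bullet> i) = DIM('a) * c (norm x) + \<epsilon> (norm x)"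
proof -
  have "(\<Sum>i\<in>Basis. blinfun_apply (field_deriv x) i \<bullet> i)
      = (\<Sum>i\<in>(Basis::'a set). c (norm x) + \<epsilon> (norm x) * ((sgn x \<bullet> i) * (sgn x \<bullet> i)))"
    by (intro sum.cong refl)
      (simp add: field_deriv_def blinfun.add_left blinfun.scaleR_left sgn_projection_apply
        inner_add_left inner_commute[of _ "sgn x"])
  also have "\<dots> = DIM('a) * c (norm x) + \<epsilon> (norm x) * (sgn x \<bullet> sgn x)"
    by (simp add: sum.distrib sum_distrib_left[symmetric] euclidean_inner[of "sgn x" "sgn x"])
  also have "\<epsilon> (norm x) * (sgn x \<bullet> sgn x) = \<epsilon> (norm x)"
    using assms \<epsilon>_0 a_nonneg by (cases "x = 0") (auto simp: norm_sgn dot_square_norm)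
  finally show ?thesis .
qed

end

section \<open>From the radial equation to the partial differential equation\<close>

lemma (in radial_interval) avg_const:
  assumes "a = 0" "s \<ge> 0"
  shows "avg (\<lambda>_. C) s = C * s / (real m + 1)"
proof (cases "s = 0")
  case True
  then show ?thesis using avg_left_end[of "\<lambda>_. C"] assms by simp
next
  case False
  have "((\<lambda>t. t ^ m * C) has_integral (C * s ^ Suc m / real (Suc m) - C * 0 ^ Suc m / real (Suc m))) {0..s}"
    using assms
    by (intro fundamental_theorem_of_calculus)
      (auto intro!: derivative_eq_intros simp flip: has_real_derivative_iff_has_vector_derivative
        simp del: power_Suc of_nat_Suc)
  then have "integral {0..s} (\<lambda>t. t ^ m * C) = C * s ^ Suc m / real (Suc m) - C * 0 ^ Suc m / real (Suc m)"
    by (rule integral_unique)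
  then show ?thesis using False unfolding avg_def unfolding assms(1) by (simp add: add.commute)
qed

text \<open>A positive solution of the radial equation, with \<open>w = u' / sqrt (1 - u'\<^sup>2)\<close>.\<close>

locale radial_profile = radial_interval +
  fixes f u w :: "real \<Rightarrow> real"
  assumes cont_fu: "continuous_on {a..b} (\<lambda>t. f (u t))"
    and w_def: "r \<in> {a..b} \<Longrightarrow> w r = - avg (\<lambda>t. f (u t)) r"
    and u_deriv: "r \<in> {a..b} \<Longrightarrow>
      (u has_real_derivative w r / sqrt (1 + (w r)\<^sup>2)) (at r within {a..b})"
    and u_pos: "r \<in> {a..b} \<Longrightarrow> u r > 0"
    and w_right_end: "w b = 0"
begin

text \<open>The value at \<open>0\<close> is the limit of \<open>w r / r\<close>: near the centre of a ball
  \<open>w r = - avg (f u) r\<close> behaves like \<open>- f (u 0) * r / (m + 1)\<close>.\<close>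

definition c :: "real \<Rightarrow> real" where
  "c r = (if r = 0 then - f (u 0) / (real m + 1) else w r / r)"

text \<open>By the equation \<open>w' = - f u - m * w / r\<close>, this is \<open>r * c' r\<close>.\<close>

definition \<epsilon> :: "real \<Rightarrow> real" where
  "\<epsilon> r = - f (u r) - (real m + 1) * c r"

lemma cont_w: "continuous_on {a..b} w"
  using continuous_on_minus[OF continuous_on_avg[OF cont_fu]]
  by (rule continuous_on_eq) (simp add: w_def)

lemma w_left_end: "w a = 0"
  using a_less_b by (simp add: w_def)

lemma w_eq: "r \<in> {a..b} \<Longrightarrow> w r = r * c r"
  using w_left_end a_nonneg by (cases "r = 0") (auto simp: c_def)

lemma cont_c: "continuous_on {a..b} c"
proof -
  have "continuous (at r within {a..b}) c" if r: "r \<in> {a..b}" for r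
  proof (cases "r = 0")
    case True
    then have a: "a = 0" using r a_nonneg by simp
    show ?thesis
      unfolding continuous_within_eps_delta
    proof (intro allI impI)
      fix \<eta> :: real assume \<eta>: "\<eta> > 0"
      then have \<eta>2: "\<eta> / 2 > 0" by simp
      obtain d where d: "d > 0" "\<forall>t\<in>{a..b}. dist t 0 < d \<longrightarrow> dist (f (u t)) (f (u 0)) < \<eta> / 2"
        using cont_fu \<eta>2 r True unfolding continuous_on_iff by blast
      show "\<exists>d>0. \<forall>x'\<in>{a..b}. dist x' r < d \<longrightarrow> dist (c x') (c r) < \<eta>"
      proof (intro exI[of _ d] conjI ballI impI d(1))
        fix s assume s: "s \<in> {a..b}" and ds: "dist s r < d"
        show "dist (c s) (c r) < \<eta>"
        proof (cases "s = 0")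
          case True
          then show ?thesis using \<open>r = 0\<close> \<eta> by simp
        next
          case False
          then have s_pos: "s > 0" using s a by simp
          have "\<bar>avg (\<lambda>t. f (u t) - f (u 0)) s\<bar> \<le> integral {a..s} (\<lambda>_. \<eta> / 2)"
          proof (rule abs_avg_le)
            fix t assume t: "t \<in> {a..s}"
            then have "t \<in> {a..b}" "dist t 0 < d" using s ds a True by (auto simp: dist_real_def)
            then show "\<bar>f (u t) - f (u 0)\<bar> \<le> \<eta> / 2" using d(2) by (auto simp: dist_real_def less_imp_le)
          qed (use s cont_fu in \<open>auto intro!: continuous_on_diff continuous_on_const\<close>)
          also have "\<dots> = s * (\<eta> / 2)" using s_pos a by simp
          finally have "\<bar>avg (\<lambda>t. f (u t) - f (u 0)) s\<bar> / s \<le> \<eta> / 2"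
            using s_pos by (simp add: field_simps)
          moreover have "c s - c r = - avg (\<lambda>t. f (u t) - f (u 0)) s / s"
          proof -
            have "avg (\<lambda>t. f (u t) - f (u 0)) s = - w s - f (u 0) * s / (real m + 1)"
              using avg_diff[OF cont_fu continuous_on_const s, of "f (u 0)"] avg_const[OF a, of s] s_pos s
              by (simp add: w_def)
            then show ?thesis using s_pos True by (simp add: c_def divide_simps)
          qed
          ultimately have "\<bar>c s - c r\<bar> \<le> \<eta> / 2"
            using s_pos by (simp add: abs_divide del: minus_divide_left)
          then show ?thesis using \<eta> by (simp add: dist_real_def)
        qed
      qed
    qed
  next
    case False
    have "continuous (at r within {a..b}) w"
      using cont_w r by (simp add: continuous_on_eq_continuous_within)
    then have "continuous (at r within {a..b}) (\<lambda>r. w r / r)"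
      using False by (intro continuous_at_within_divide continuous_ident)
    then have lim: "((\<lambda>r. w r / r) \<longlongrightarrow> c r) (at r within {a..b})"
      using False by (simp add: continuous_within c_def)
    have "\<forall>\<^sub>F s in at r within {a..b}. w s / s = c s"
      using eventually_neq_at_within[of 0 r "{a..b}"] by eventually_elim (simp add: c_def)
    then have "(c \<longlongrightarrow> c r) (at r within {a..b})"
      by (rule Lim_transform_eventually[OF lim])
    then show ?thesis by (simp add: continuous_within)
  qed
  then show ?thesis by (simp add: continuous_on_eq_continuous_within)
qed

lemma cont_\<epsilon>: "continuous_on {a..b} \<epsilon>"
  unfolding \<epsilon>_def by (intro continuous_intros cont_fu cont_c)

lemma \<epsilon>_0: "\<epsilon> 0 = 0"
  by (simp add: \<epsilon>_def c_def)

lemma c_deriv: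
  assumes r: "r \<in> {a<..<b}"
  shows "(c has_real_derivative \<epsilon> r / r) (at r)"
proof -
  have r_pos: "r > 0" using r a_nonneg by simp
  define I where "I s = integral {a..s} (\<lambda>t. t ^ m * f (u t))" for s
  have "(I has_real_derivative r ^ m * f (u r)) (at r within {a..b})"
    unfolding I_def using r
    by (intro integral_has_real_derivative continuous_intros cont_fu) auto
  then have dI: "(I has_real_derivative r ^ m * f (u r)) (at r)"
    using r by (simp add: at_within_Icc_at)
  have "((\<lambda>s. - I s / s ^ Suc m) has_real_derivative
      - ((r ^ m * f (u r) * r ^ Suc m - I r * (real (Suc m) * r ^ m)) / (r ^ Suc m * r ^ Suc m))) (at r)"
    using r_pos by (auto intro!: derivative_eq_intros dI simp del: power_Suc of_nat_Suc)
  moreover have "- ((r ^ m * f (u r) * r ^ Suc m - I r * (real (Suc m) * r ^ m)) / (r ^ Suc m * r ^ Suc m))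
      = \<epsilon> r / r"
  proof -
    have "I r = - (r ^ m * (r * c r))"
    proof -
      have "avg (\<lambda>t. f (u t)) r = - (r * c r)" using r w_eq[of r] w_def[of r] by simp
      then show ?thesis using power_times_avg[of r "\<lambda>t. f (u t)"] r unfolding I_def by simp
    qed
    then show ?thesis using r_pos by (simp add: \<epsilon>_def field_simps)
  qed
  ultimately have "((\<lambda>s. - I s / s ^ Suc m) has_real_derivative \<epsilon> r / r) (at r)" by simp
  then show ?thesis
  proof (rule has_field_derivative_transform_within_open[OF _ open_greaterThanLessThan r])
    fix s assume s: "s \<in> {a<..<b}"
    then have "s > 0" using a_nonneg by simp
    then show "- I s / s ^ Suc m = c s" using s by (simp add: c_def w_def avg_def I_def)
  qed
qed

definition speed :: "real \<Rightarrow> real" where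
  "speed r = sqrt (1 + (r * c r)\<^sup>2)"

text \<open>The quotient \<open>u' r / r\<close>, expressed through \<open>c\<close> so that it makes sense at \<open>0\<close>; \<open>\<delta>\<close> below is
  \<open>r * d' r\<close>.\<close>

definition d :: "real \<Rightarrow> real" where
  "d r = c r / speed r"

definition \<delta> :: "real \<Rightarrow> real" where
  "\<delta> r = \<epsilon> r / speed r - (r * c r)\<^sup>2 * (c r + \<epsilon> r) / speed r ^ 3"

lemma speed_pos: "speed r > 0"
  by (simp add: speed_def add_pos_nonneg)

lemma cont_speed: "continuous_on {a..b} speed"
  unfolding speed_def by (intro continuous_intros cont_c)

lemma cont_d: "continuous_on {a..b} d"
  unfolding d_def using speed_pos by (intro continuous_intros cont_c cont_speed) (auto simp: less_imp_neq[symmetric])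

lemma cont_\<delta>: "continuous_on {a..b} \<delta>"
  unfolding \<delta>_def using speed_pos
  by (intro continuous_intros cont_c cont_\<epsilon> cont_speed) (auto simp: less_imp_neq[symmetric])

lemma \<delta>_0: "\<delta> 0 = 0"
  by (simp add: \<delta>_def \<epsilon>_0)

lemma d_deriv:
  assumes r: "r \<in> {a<..<b}"
  shows "(d has_real_derivative \<delta> r / r) (at r)"
proof -
  have r_pos: "r > 0" using r a_nonneg by simp
  have sp: "speed r > 0" by (rule speed_pos)
  have arg: "1 + (r * c r)\<^sup>2 > 0" by (simp add: add_pos_nonneg)
  have "(speed has_real_derivative (r * c r) * (c r + \<epsilon> r) / speed r) (at r)"
    unfolding speed_def using arg r_pos
    by (auto intro!: derivative_eq_intros c_deriv[OF r] simp: divide_simps) (simp add: algebra_simps power2_eq_square)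
  then have "(d has_real_derivative
      (\<epsilon> r / r * speed r - c r * ((r * c r) * (c r + \<epsilon> r) / speed r)) / (speed r * speed r)) (at r)"
    unfolding d_def using sp by (intro DERIV_divide c_deriv[OF r]) auto
  moreover have "(\<epsilon> r / r * speed r - c r * ((r * c r) * (c r + \<epsilon> r) / speed r)) / (speed r * speed r)
      = \<delta> r / r"
  proof -
    have "(e / t * s - k * ((t * k) * (k + e) / s)) / (s * s) = (e / s - (t * k)\<^sup>2 * (k + e) / s ^ 3) / t"
      if "s \<noteq> 0" "t \<noteq> 0" for e s t k :: real
      using that by (simp add: field_simps power2_eq_square power3_eq_cube)
    then show ?thesis using sp r_pos unfolding \<delta>_def by (metis less_irrefl)
  qed
  ultimately show ?thesis by simp
qed

sublocale V: radial_field m a b c \<epsilon>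
  by unfold_locales (use cont_c cont_\<epsilon> c_deriv \<epsilon>_0 in auto)

sublocale G: radial_field m a b d \<delta>
  by unfold_locales (use cont_d cont_\<delta> d_deriv \<delta>_0 in auto)

lemma u_deriv_d: "r \<in> {a..b} \<Longrightarrow> (u has_real_derivative r * d r) (at r within {a..b})"
  using u_deriv[of r] w_eq[of r] by (simp add: d_def speed_def)

lemma cont_u: "continuous_on {a..b} u"
  by (rule DERIV_continuous_on[OF u_deriv_d])

lemma radial_has_derivative:
  fixes x :: "'a::euclidean_space"
  assumes x: "norm x \<in> {a<..<b} \<or> a = 0 \<and> x = 0"
  shows "((\<lambda>x. u (norm x)) has_derivative (\<lambda>h. G.field x \<bullet> h)) (at x)"
proof (cases "x = 0")
  case False
  then have r: "norm x \<in> {a<..<b}" using x by auto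
  have "(u has_real_derivative norm x * d (norm x)) (at (norm x))"
    using u_deriv_d[of "norm x"] r by (simp add: at_within_Icc_at)
  from has_derivative_compose[OF has_derivative_norm[OF False] this[unfolded has_field_derivative_def]]
  have "((\<lambda>x. u (norm x)) has_derivative (\<lambda>h. norm x * d (norm x) * (h \<bullet> sgn x))) (at x)" .
  moreover have "norm x * d (norm x) * (h \<bullet> sgn x) = G.field x \<bullet> h" for h
    using False by (simp add: G.field_def sgn_div_norm inner_commute)
  ultimately show ?thesis by simp
next
  case True
  then have a: "a = 0" using x a_nonneg by auto
  have "(u has_real_derivative 0) (at 0 within {0..b})"
    using u_deriv_d[of 0] a a_less_b by simp
  then have u0: "((\<lambda>r. (u r - u 0) / (r - 0)) \<longlongrightarrow> 0) (at 0 within {0..b})"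
    by (simp add: has_field_derivative_iff)
  have "filterlim (\<lambda>h::'a. norm h) (at 0 within {0..b}) (at 0)"
    unfolding filterlim_at
  proof
    have "\<forall>\<^sub>F h in at (0::'a). h \<in> ball 0 b"
      using a a_less_b by (intro eventually_at_in_open') auto
    moreover have "\<forall>\<^sub>F h in at (0::'a). h \<noteq> 0" by (simp add: eventually_at_filter)
    ultimately show "\<forall>\<^sub>F h in at (0::'a). norm h \<in> {0..b} \<and> norm h \<noteq> 0"
      by eventually_elim auto
    show "((\<lambda>h::'a. norm h) \<longlongrightarrow> 0) (at 0)" by (rule tendsto_norm_zero) (rule tendsto_ident_at)
  qed
  from filterlim_compose[OF u0 this]
  have "((\<lambda>h::'a. (u (norm h) - u 0) / norm h) \<longlongrightarrow> 0) (at 0)" by simp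
  then have "((\<lambda>x::'a. u (norm x)) has_derivative (\<lambda>h. 0)) (at 0)"
    by (simp add: has_derivative_at divide_inverse mult.commute has_derivative_within)
  then show ?thesis using True by (simp add: G.field_def)
qed

text \<open>Along the normal line the norm is an affine function of the parameter with slope \<open>\<sigma>\<close>, so the
  normal derivative is \<open>\<sigma>\<close> times the radial derivative at the end point, which is \<open>0\<close>.\<close>

lemma radial_normal_derivative:
  assumes x: "norm x = b \<or> 0 < a \<and> norm x = a"
  shows "has_normal_derivative (\<lambda>x. u (norm x)) (outer_normal a x) x 0"
proof -
  define \<sigma> :: real where "\<sigma> = (if norm x = a then - 1 else 1)"
  define S where "S = {- (b - a)..0}"
  have nx: "norm x > 0" and x_ne: "x \<noteq> 0" using x a_nonneg a_less_b by auto
  have on: "outer_normal a x = \<sigma> *\<^sub>R sgn x" by (simp add: outer_normal_def \<sigma>_def)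
  have range: "norm x + t * \<sigma> \<in> {a..b}" if "t \<in> S" for t
    using that x a_less_b by (auto simp: \<sigma>_def S_def)
  have norm_eq: "norm (x + t *\<^sub>R outer_normal a x) = norm x + t * \<sigma>" if "t \<in> S" for t
  proof -
    have "x + t *\<^sub>R outer_normal a x = (norm x + t * \<sigma>) *\<^sub>R sgn x"
    proof -
      have "norm x *\<^sub>R sgn x = x" using nx by (simp add: sgn_div_norm)
      then show ?thesis by (simp add: on scaleR_left_distrib)
    qed
    then show ?thesis using range[OF that] a_nonneg x_ne by (simp add: norm_sgn)
  qed
  have rx: "norm x \<in> {a..b}" and w0: "w (norm x) = 0"
    using x w_right_end w_left_end a_less_b by auto
  have "(u has_real_derivative 0) (at (norm x) within {a..b})"
    using u_deriv[OF rx] w0 by simp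
  moreover have "(\<lambda>t. norm x + t * \<sigma>) ` S \<subseteq> {a..b}" using range by blast
  ultimately have "(u has_real_derivative 0) (at (norm x) within (\<lambda>t. norm x + t * \<sigma>) ` S)"
    by (rule DERIV_subset)
  then have "(u has_real_derivative 0) (at (norm x + 0 * \<sigma>) within (\<lambda>t. norm x + t * \<sigma>) ` S)"
    by simp
  moreover have "((\<lambda>t. norm x + t * \<sigma>) has_real_derivative \<sigma>) (at 0 within S)"
    by (auto intro!: derivative_eq_intros)
  ultimately have "((\<lambda>t. u (norm x + t * \<sigma>)) has_real_derivative 0) (at 0 within S)"
    using DERIV_image_chain[of u 0 "\<lambda>t. norm x + t * \<sigma>" 0 S \<sigma>] by (simp add: o_def)
  then have "((\<lambda>t. u (norm (x + t *\<^sub>R outer_normal a x))) has_real_derivative 0) (at 0 within S)"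
    by (rule has_field_derivative_transform_within[OF _ zero_less_one])
      (use norm_eq a_less_b in \<open>auto simp: S_def\<close>)
  then show ?thesis
    using a_less_b by (simp add: has_normal_derivative_def S_def at_within_Icc_at_left)
qed

text \<open>The gradient is the field of \<open>d\<close>, and its product with the Lorentz factor is the field of \<open>c\<close>.
  The trace of the derivative of the latter is \<open>(m + 1) * c + \<epsilon> = - f u\<close>.\<close>

lemma radial_solution:
  fixes \<Omega> :: "'a::euclidean_space set"
  assumes dim: "DIM('a) = Suc m"
    and domain: "(0 < a \<and> \<Omega> = {x. a < norm x \<and> norm x < b}) \<or> (a = 0 \<and> \<Omega> = {x. norm x < b})"
  shows "minkowski_neumann_solution \<Omega> (outer_normal a) f (\<lambda>x. u (norm x))"
proof -
  have in_\<Omega>: "norm x \<in> {a<..<b} \<or> a = 0 \<and> x = 0" if "x \<in> \<Omega>" for x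
    using that domain by auto
  have \<Omega>_sub: "\<Omega> \<subseteq> {x. norm x \<in> {a..b}}" using domain by auto
  have open_\<Omega>: "open \<Omega>"
    using domain by (auto intro!: open_Collect_conj open_Collect_less continuous_intros)
  have closed: "closed {x::'a. norm x \<in> {a..b}}"
    by (auto intro!: closed_Collect_conj closed_Collect_le continuous_intros)
  have closure_sub: "closure \<Omega> \<subseteq> {x. norm x \<in> {a..b}}"
    by (rule closure_minimal[OF \<Omega>_sub closed])
  have frontier: "norm x = b \<or> 0 < a \<and> norm x = a" if "x \<in> frontier \<Omega>" for x
  proof -
    have "x \<in> closure \<Omega>" "x \<notin> \<Omega>"
      using that interior_open[OF open_\<Omega>] by (auto simp: frontier_def)
    then show ?thesis using closure_sub domain by force
  qed
  have grad: "gradient (\<lambda>x. u (norm x)) x = G.field x" if "x \<in> \<Omega>" for x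
  proof -
    have "frechet_derivative (\<lambda>x. u (norm x)) (at x) = (\<lambda>h. G.field x \<bullet> h)"
      using frechet_derivative_at[OF radial_has_derivative[OF in_\<Omega>[OF that]]] by simp
    then show ?thesis by (simp add: gradient_def euclidean_representation)
  qed
  have norm_field: "(norm (G.field x))\<^sup>2 = (norm x * c (norm x))\<^sup>2 / (speed (norm x))\<^sup>2" for x :: 'a
    by (simp add: G.field_def d_def power_mult_distrib power_divide)
  have speed_sq: "(speed r)\<^sup>2 = 1 + (r * c r)\<^sup>2" for r
    by (simp add: speed_def add_nonneg_nonneg)
  have compl: "1 - (norm (G.field x))\<^sup>2 = 1 / (speed (norm x))\<^sup>2" for x :: 'a
  proof -
    have "(norm (G.field x))\<^sup>2 = ((speed (norm x))\<^sup>2 - 1) / (speed (norm x))\<^sup>2"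
      unfolding norm_field speed_sq by simp
    then show ?thesis using speed_pos[of "norm x"] by (simp add: field_simps)
  qed
  have spacelike: "norm (G.field x) < 1" for x :: 'a
  proof -
    have "1 - (norm (G.field x))\<^sup>2 > 0" unfolding compl using speed_pos[of "norm x"] by simp
    then have "(norm (G.field x))\<^sup>2 < 1\<^sup>2" by simp
    then show ?thesis by (rule power2_less_imp_less) simp
  qed
  have flux_field: "(1 / sqrt (1 - (norm (G.field x))\<^sup>2)) *\<^sub>R G.field x = V.field x" for x :: 'a
  proof -
    have "speed (norm x) > 0" by (rule speed_pos)
    then show ?thesis unfolding compl unfolding G.field_def V.field_def d_def
      by (simp add: real_sqrt_divide less_imp_neq[symmetric])
  qed
  have div: "- divergence (\<lambda>y. (1 / sqrt (1 - (norm (gradient (\<lambda>x. u (norm x)) y))\<^sup>2)) *\<^sub>R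
      gradient (\<lambda>x. u (norm x)) y) x = f (u (norm x))" if x: "x \<in> \<Omega>" for x :: 'a
  proof -
    let ?F = "\<lambda>y::'a. (1 / sqrt (1 - (norm (gradient (\<lambda>x. u (norm x)) y))\<^sup>2)) *\<^sub>R gradient (\<lambda>x. u (norm x)) y"
    have "(?F has_derivative blinfun_apply (V.field_deriv x)) (at x)"
    proof (rule has_derivative_transform_within_open[OF V.field_has_derivative[OF in_\<Omega>[OF x]] open_\<Omega> x])
      fix y assume "y \<in> \<Omega>"
      then show "V.field y = ?F y" by (simp add: grad flux_field)
    qed
    then have "frechet_derivative ?F (at x) = blinfun_apply (V.field_deriv x)"
      by (rule frechet_derivative_at[symmetric])
    then have "divergence ?F x = (\<Sum>i\<in>Basis. blinfun_apply (V.field_deriv x) i \<bullet> i)"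
      unfolding divergence_def by simp
    also have "\<dots> = real (DIM('a)) * c (norm x) + \<epsilon> (norm x)"
      by (rule V.trace_field_deriv[OF in_\<Omega>[OF x]])
    also have "\<dots> = - f (u (norm x))" by (simp add: dim \<epsilon>_def algebra_simps)
    finally show ?thesis by simp
  qed
  have "C2_closure \<Omega> (\<lambda>x. u (norm x))"
    unfolding C2_closure_def
  proof (intro conjI exI ballI)
    show "continuous_on (closure \<Omega>) (\<lambda>x. u (norm x))"
      using closure_sub by (intro continuous_on_compose2[OF cont_u] continuous_intros) auto
    show "continuous_on (closure \<Omega>) G.field"
      by (rule continuous_on_subset[OF G.continuous_field closure_sub])
    show "continuous_on (closure \<Omega>) G.field_deriv"
      by (rule continuous_on_subset[OF G.continuous_field_deriv closure_sub])
    fix x assume x: "x \<in> \<Omega>"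
    show "((\<lambda>x. u (norm x)) has_derivative (\<lambda>h. G.field x \<bullet> h)) (at x)"
      by (rule radial_has_derivative[OF in_\<Omega>[OF x]])
    show "(G.field has_derivative blinfun_apply (G.field_deriv x)) (at x)"
      by (rule G.field_has_derivative[OF in_\<Omega>[OF x]])
  qed
  then show ?thesis
    unfolding minkowski_neumann_solution_def
  proof (intro conjI ballI)
    show "has_normal_derivative (\<lambda>x. u (norm x)) (outer_normal a x) x 0" if "x \<in> frontier \<Omega>" for x
      by (rule radial_normal_derivative[OF frontier[OF that]])
    show "norm (gradient (\<lambda>x. u (norm x)) x) < 1" if "x \<in> \<Omega>" for x
      using spacelike grad[OF that] by simp
    show "u (norm x) > 0" if "x \<in> \<Omega>" for x
      using u_pos \<Omega>_sub that by blast
  qed (assumption, rule div)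
qed

end

section \<open>Multiplicity of solutions\<close>

theorem corollary1p2:
  fixes \<Omega> :: "'a::euclidean_space set"
    and R1 R2 p q lam :: real
    and f :: "real \<Rightarrow> real"
    and k :: nat
  assumes domain: "(0 < R1 \<and> R1 < R2 \<and> \<Omega> = {x. R1 < norm x \<and> norm x < R2}) \<or>
                   (R1 = 0 \<and> 0 < R2 \<and> \<Omega> = {x. norm x < R2})"
    and f: "\<And>s. s \<ge> 0 \<Longrightarrow> f s = s powr (q - 1) - s powr (p - 1)"
    and p: "p \<ge> 2"
    and k: "k \<ge> 1"
    and eig: "is_kth_radial_neumann_eigenvalue DIM('a) R1 R2 (k + 1) lam"
    and q: "q - p > lam"
  shows "\<exists>u :: nat \<Rightarrow> real \<Rightarrow> real.
    (\<forall>j\<in>{1..2 * k}.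
       minkowski_neumann_solution \<Omega> (outer_normal R1) f (\<lambda>x. u j (norm x)) \<and>
       \<not> (\<lambda>x. u j (norm x)) constant_on \<Omega>) \<and>
    (\<forall>i\<in>{1..2 * k}. \<forall>j\<in>{1..2 * k}. i \<noteq> j \<longrightarrow> (\<exists>x\<in>\<Omega>. u i (norm x) \<noteq> u j (norm x))) \<and>
    (\<forall>j\<in>{1..k}. u j R1 < 1) \<and>
    (\<forall>j\<in>{k + 1..2 * k}. u j R1 > 1) \<and>
    (\<forall>j\<in>{1..k}. card {r\<in>{R1<..<R2}. u j r - 1 = 0} = j \<and>
                card {r\<in>{R1<..<R2}. u (j + k) r - 1 = 0} = j)"
proof -
  obtain m where m: "DIM('a) = Suc m" using DIM_positive[where 'a = 'a] gr0_implies_Suc by blast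
  interpret radial_interval m R1 R2 using domain by unfold_locales auto
  note eig' = eig[unfolded m]
  have "lam \<ge> 0"
    using eig' eigenvalue_nonneg by (simp add: is_kth_radial_neumann_eigenvalue_def)
  define E where "E = R2 - R1 + 1"
  have E: "E > 0" using a_less_b by (simp add: E_def)
  \<comment> \<open>\<open>2 * E\<close> bounds the shooting solutions with \<open>e < E\<close>: they start below \<open>1 + E\<close> and have slope at most \<open>1\<close>\<close>
  interpret minkowski_shooting m R1 R2 p q "2 * E"
    using \<open>lam \<ge> 0\<close> p q a_less_b by unfold_locales (auto simp: E_def)
  have "rescaled_velocity 0 = (\<lambda>x. x)" "rescaled_force 0 = (\<lambda>x. (q - p) * x)"
    by (auto simp: rescaled_velocity_def rescaled_force_def slope_def)
  then have "rot 0 = linear_rotation (q - p)"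
    by (simp add: rot_def linear_rotation_def rescaled_profile_def linear_sol_def)
  then have rot_0: "rot 0 > real k * pi"
    using kth_eigenvalue_rotation[OF eig'] linear_rotation_strict_mono[OF q] by simp
  have between: "0 < real j * pi \<and> real j * pi < rot 0 \<and> pi \<le> real j * pi" if j: "j \<in> {1..k}" for j
  proof -
    have "real j * pi \<le> real k * pi" using j by (intro mult_right_mono) auto
    moreover have "1 * pi \<le> real j * pi" using j by (intro mult_right_mono) auto
    ultimately show ?thesis using rot_0 pi_gt_zero by linarith
  qed
  have "\<exists>e. -1 < e \<and> e < 0 \<and> rot e = real j * pi" if j: "j \<in> {1..k}" for j
  proof -
    have "\<exists>e\<ge>-1. e \<le> 0 \<and> rot e = real j * pi"
      using between[OF j] rot_minus_one by (intro IVT' continuous_rot) auto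
    then show ?thesis using between[OF j] rot_minus_one by (metis less_eq_real_def less_irrefl)
  qed
  then obtain e_lo where lo: "\<And>j. j \<in> {1..k} \<Longrightarrow> -1 < e_lo j \<and> e_lo j < 0 \<and> rot (e_lo j) = real j * pi"
    by metis
  have "\<exists>e. 0 < e \<and> e < E \<and> rot e = real j * pi" if j: "j \<in> {1..k}" for j
  proof -
    have rE: "rot E < real j * pi" using between[OF j] rot_large[folded E_def] by linarith
    then have "\<exists>e\<ge>0. e \<le> E \<and> rot e = real j * pi"
      using between[OF j] E by (intro IVT2' continuous_rot) auto
    then show ?thesis using between[OF j] rE by (metis less_eq_real_def less_irrefl)
  qed
  then obtain e_hi where hi: "\<And>j. j \<in> {1..k} \<Longrightarrow> 0 < e_hi j \<and> e_hi j < E \<and> rot (e_hi j) = real j * pi"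
    by metis
  \<comment> \<open>the first \<open>k\<close> solutions start below \<open>1\<close>, the others above; \<open>n j\<close> is the number of half turns\<close>
  define e where "e j = (if j \<le> k then e_lo j else e_hi (j - k))" for j
  define n where "n j = (if j \<le> k then j else j - k)" for j
  define u where "u j = shoot (e j)" for j
  have nk: "n j \<in> {1..k}" if "j \<in> {1..2 * k}" for j using that by (auto simp: n_def)
  have ej: "-1 < e j" "e j < E" "e j \<noteq> 0" "rot (e j) = real (n j) * pi" if "j \<in> {1..2 * k}" for j
  proof -
    have "-1 < e j \<and> e j < E \<and> e j \<noteq> 0 \<and> rot (e j) = real (n j) * pi"
    proof (cases "j \<le> k")
      case True
      then show ?thesis using lo[of j] that E by (simp add: e_def n_def)
    next
      case False
      then have "j - k \<in> {1..k}" using that by auto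
      from hi[OF this] show ?thesis using False by (auto simp: e_def n_def)
    qed
    then show "-1 < e j" "e j < E" "e j \<noteq> 0" "rot (e j) = real (n j) * pi" by blast+
  qed
  have start: "u j R1 = 1 + e j" for j by (simp add: u_def shoot_left_end)
  have low: "u j R1 < 1" if "j \<in> {1..k}" for j
    using lo[OF that] that by (simp add: start e_def)
  have high: "u j R1 > 1" if "j \<in> {k + 1..2 * k}" for j
  proof -
    have "j - k \<in> {1..k}" "\<not> j \<le> k" using that by auto
    then show ?thesis using hi[of "j - k"] by (simp add: start e_def)
  qed
  have card: "card {r \<in> {R1<..<R2}. u j r - 1 = 0} = n j" if "j \<in> {1..2 * k}" for j
    unfolding u_def using ej[OF that] by (intro card_shoot_zeros) auto
  have profile: "radial_profile m R1 R2 f (u j) (shoot_flux (e j))" if j: "j \<in> {1..2 * k}" for j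
  proof -
    have pos: "u j r > 0" if "r \<in> {R1..R2}" for r
      unfolding u_def using shoot_positive[OF ej(1,4)[OF j] that] .
    have le: "u j r \<le> 2 * E" if "r \<in> {R1..R2}" for r
      using shoot_near_start[OF that, of "e j"] ej(2)[OF j] by (simp add: u_def E_def)
    have f_eq: "f (u j r) = trunc (u j r)" if "r \<in> {R1..R2}" for r
      using pos[OF that] le[OF that] by (simp add: f trunc_eq)
    have cu: "continuous_on {R1..R2} (u j)"
      unfolding u_def by (rule DERIV_continuous_on[OF shoot_deriv])
    show ?thesis
    proof unfold_locales
      have "continuous_on {R1..R2} (\<lambda>t. trunc (u j t))"
        by (rule continuous_on_compose2[OF continuous_trunc cu]) simp
      then show "continuous_on {R1..R2} (\<lambda>t. f (u j t))"
        by (rule continuous_on_eq) (simp add: f_eq)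
      show "shoot_flux (e j) r = - avg (\<lambda>t. f (u j t)) r" if "r \<in> {R1..R2}" for r
      proof -
        have "integral {R1..r} (\<lambda>t. t ^ m * trunc (u j t)) = integral {R1..r} (\<lambda>t. t ^ m * f (u j t))"
          using that by (intro integral_cong) (simp add: f_eq)
        then show ?thesis by (simp add: shoot_flux_def avg_def u_def)
      qed
      show "(u j has_real_derivative shoot_flux (e j) r / sqrt (1 + (shoot_flux (e j) r)\<^sup>2)) (at r within {R1..R2})"
        if "r \<in> {R1..R2}" for r
        unfolding u_def by (rule shoot_deriv[OF that])
      show "shoot_flux (e j) R2 = 0" by (rule shoot_flux_right_end[OF ej(4)[OF j]])
    qed (rule pos)
  qed
  have cont: "continuous_on {R1..R2} (u j)" for j
    unfolding u_def by (rule DERIV_continuous_on[OF shoot_deriv])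
  have point: "\<exists>x\<in>\<Omega>. norm x = r" if r: "r \<in> {R1<..<R2}" for r
  proof -
    have "r \<ge> 0" using r a_nonneg by simp
    then obtain x :: 'a where "norm x = r" by (rule vector_choose_size)
    then show ?thesis using domain r by auto
  qed
  have distinct: "\<exists>x\<in>\<Omega>. u i (norm x) \<noteq> u j (norm x)"
    if i: "i \<in> {1..2 * k}" and j: "j \<in> {1..2 * k}" and ij: "i \<noteq> j" for i j
  proof (rule ccontr)
    assume "\<not> ?thesis"
    then have eq: "u i r = u j r" if "r \<in> {R1<..<R2}" for r using point[OF that] by auto
    then have "{r \<in> {R1<..<R2}. u i r - 1 = 0} = {r \<in> {R1<..<R2}. u j r - 1 = 0}" by auto
    then have nij: "n i = n j" using card[OF i] card[OF j] by metis
    \<comment> \<open>solutions that agree in the domain have the same initial value, hence belong to the same group\<close>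
    have "u i R1 - u j R1 = 0"
    proof (rule continuous_constant_on_closure[of "{R1<..<R2}" "\<lambda>r. u i r - u j r"])
      show "continuous_on (closure {R1<..<R2}) (\<lambda>r. u i r - u j r)"
        using a_less_b by (auto intro!: continuous_on_diff cont)
    qed (use eq a_less_b in auto)
    then have "(i \<le> k) = (j \<le> k)" using low[of i] low[of j] high[of i] high[of j] i j
      by (cases "i \<le> k"; cases "j \<le> k") auto
    then show False using nij ij by (auto simp: n_def split: if_splits)
  qed
  have nonconst: "\<not> (\<lambda>x. u j (norm x)) constant_on \<Omega>" if j: "j \<in> {1..2 * k}" for j
  proof
    assume "(\<lambda>x. u j (norm x)) constant_on \<Omega>"
    then obtain C where C: "\<And>x. x \<in> \<Omega> \<Longrightarrow> u j (norm x) = C" unfolding constant_on_def by auto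
    then have const: "u j r = C" if "r \<in> {R1<..<R2}" for r using point[OF that] by auto
    have "card {r \<in> {R1<..<R2}. u j r - 1 = 0} \<noteq> 0" using card[OF j] nk[OF j] by simp
    then obtain r where "r \<in> {R1<..<R2}" "u j r - 1 = 0" by (metis (mono_tags, lifting) card_eq_0_iff empty_Collect_eq)
    then have "C = 1" using const by force
    then have "{r \<in> {R1<..<R2}. u j r - 1 = 0} = {R1<..<R2}" using const by auto
    then show False using card[OF j] nk[OF j] infinite_Ioo[OF a_less_b] by simp
  qed
  show ?thesis
  proof (intro exI[of _ u] conjI ballI impI)
    fix j assume j: "j \<in> {1..2 * k}"
    interpret radial_profile m R1 R2 f "u j" "shoot_flux (e j)" by (rule profile[OF j])
    show "minkowski_neumann_solution \<Omega> (outer_normal R1) f (\<lambda>x. u j (norm x))"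
      using domain by (intro radial_solution m) auto
    show "\<not> (\<lambda>x. u j (norm x)) constant_on \<Omega>" by (rule nonconst[OF j])
  next
    fix j assume j: "j \<in> {1..k}"
    show "u j R1 < 1" by (rule low[OF j])
    show "card {r \<in> {R1<..<R2}. u j r - 1 = 0} = j"
      using card[of j] j by (simp add: n_def)
    show "card {r \<in> {R1<..<R2}. u (j + k) r - 1 = 0} = j"
      using card[of "j + k"] j by (simp add: n_def)
  qed (use distinct high in auto)
qed

end
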